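(* Let $p$ be an odd prime. (i) We have $$\sum_{k=0}^{\lfloor 3p/4\rfloor}\frac{\binom{2k}{k}^2}{16^k}\equiv\begin{cases}1\pmod{p^3}&\text{if } p\equiv1\pmod 4,\\[4pt] -1+\dfrac{p^2}{2\binom{(p-3)/2}{(p-3)/4}^2}\pmod{p^3}&\text{if } p\equiv3\pmod 4.\end{cases}$$ (ii) For each integer $a\ge 2$, we have $$\sum_{k=0}^{\lfloor\frac34p^a\rfloor}\frac{\binom{2k}{k}^2}{16^k}\equiv\left(\frac{-1}{p^a}\right)\pmod{p^3}.$$
   Context: $\left(\frac{\cdot}{\cdot}\right)$ denotes the Jacobi symbol; in particular $\left(\frac{-1}{p^a}\right)=(-1)^{a(p-1)/2}$. For rational numbers $x,y$ whose denominators are prime to $p$, $x\equiv y\pmod{p^m}$ means that $x-y$ is $p^m$ times a rational number with denominator prime to $p$. *)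

theory Defs
  imports "HOL-Number_Theory.Number_Theory"
begin

definition p_integral :: "nat \<Rightarrow> rat \<Rightarrow> bool"
  where "p_integral p x \<longleftrightarrow> coprime (snd (quotient_of x)) (int p)"

definition rat_cong :: "rat \<Rightarrow> rat \<Rightarrow> nat \<Rightarrow> nat \<Rightarrow> bool"
  where "rat_cong x y p m \<longleftrightarrow>
    p_integral p x \<and> p_integral p y \<and> (\<exists>r. p_integral p r \<and> x - y = of_nat (p ^ m) * r)"

text \<open>Only meaningful for odd \<^term>\<open>n\<close>: at the prime 2, \<^const>\<open>Legendre\<close> is not the Kronecker symbol.\<close>

definition Jacobi :: "int \<Rightarrow> nat \<Rightarrow> int"
  where "Jacobi a n = (\<Prod>q\<in>#prime_factorization n. Legendre a (int q))"

lemma Jacobi_prime_power: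
  assumes "prime p"
  shows "Jacobi a (p ^ k) = Legendre a (int p) ^ k"
  using assms by (simp add: Jacobi_def prime_factorization_prime_power)

end

theory Submission
  imports Defs "HOL-Computational_Algebra.Polynomial"
begin

text \<open>
  Write \<open>a\<^sub>k = C(2k,k) / 4\<^sup>k\<close>, \<open>S\<^sub>N = a\<^sub>0\<^sup>2 + \<dots> + a\<^sub>N\<^sup>2\<close>, \<open>p = 2m + 1\<close> and \<open>\<epsilon> = (-1)\<^sup>m\<close>.
  Deform \<open>S\<^sub>N\<close> to \<open>S\<^sub>N(X) = \<Sum>\<^sub>k\<^sub>\<le>\<^sub>N a\<^sub>k\<^sup>2 \<Prod>\<^sub>j\<^sub>\<le>\<^sub>k (1 - X\<^sup>2/(2j-1)\<^sup>2)\<close>. The sum \<open>S\<^sub>N(X) + S\<^sub>N(X-2)\<close>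
  telescopes to a product, so \<open>S\<^sub>N(2j+1) = (-1)\<^sup>j\<close> for \<open>j \<le> N\<close>, and \<open>S\<^sub>N(p) = \<epsilon>\<close> determines \<open>S\<^sub>N = S\<^sub>N(0)\<close>
  modulo \<open>p\<^sup>3\<close> up to the coefficient of \<open>X\<^sup>2\<close> modulo \<open>p\<close>. Modulo \<open>p\<close> the products for \<open>N = m\<close> and \<open>N = p - 1\<close>
  become \<open>- 2 (Z\<^sup>p\<^sup>-\<^sup>1 - 1)\<close> and \<open>2 (Z\<^sup>p\<^sup>-\<^sup>1 - 1)\<^sup>2\<close> with \<open>Z = X - 1\<close>; their sum has vanishing second derivative at all
  residues, so the two coefficients cancel and \<open>S\<^sub>m + S\<^sub>p\<^sub>-\<^sub>1 \<equiv> 2\<epsilon>\<close> modulo \<open>p\<^sup>3\<close>.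
  For \<open>m < k < p\<close> one has \<open>a\<^sub>k\<^sup>2 \<equiv> p\<^sup>2 / C(m-1, k-m-1)\<^sup>2\<close>, which is symmetric about \<open>3p/4\<close>; hence \<open>S\<^sub>3\<^sub>p\<^sub>/\<^sub>4\<close> is the average of
  \<open>S\<^sub>m\<close> and \<open>S\<^sub>p\<^sub>-\<^sub>1\<close>, up to half of the middle term when \<open>p \<equiv> 3 (mod 4)\<close>.

  For \<open>p\<^sup>a\<close>, split off the top base-\<open>p\<close> digit: \<open>a\<^sub>k\<close> for \<open>k = p\<^sup>a\<^sup>-\<^sup>1 K + r\<close> is \<open>a\<^sub>K\<close> times a \<open>p\<close>-integral number congruent
  to \<open>a\<^sub>r\<close> modulo \<open>p\<close>. Together with \<open>S\<^sub>N(p\<^sup>a) = \<epsilon>\<^sup>a\<close> for \<open>N = (p\<^sup>a - 1)/2\<close> this multiplies the result for \<open>p\<close> by \<open>\<epsilon>\<^sup>a\<^sup>-\<^sup>1\<close>;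
  if \<open>p \<equiv> 3 (mod 4)\<close>, the middle term now occurs with only half of its block and the correction disappears.
\<close>

section \<open>Divisibility among \<open>p\<close>-integral rationals\<close>

text \<open>The fraction on the right need not be reduced, so closure under sums and products
  follows by cross-multiplication without any gcd.\<close>

lemma p_integral_iff:
  "p_integral p x \<longleftrightarrow> (\<exists>a b. b \<noteq> 0 \<and> coprime b (int p) \<and> x = of_int a / of_int b)"
proof
  assume "p_integral p x"
  moreover obtain a b where ab: "quotient_of x = (a, b)" by fastforce
  ultimately show "\<exists>a b. b \<noteq> 0 \<and> coprime b (int p) \<and> x = of_int a / of_int b"
    using quotient_of_div[OF ab] quotient_of_denom_pos[OF ab]
    by (intro exI[of _ a] exI[of _ b]) (auto simp: p_integral_def)
next
  assume "\<exists>a b. b \<noteq> 0 \<and> coprime b (int p) \<and> x = of_int a / of_int b"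
  then obtain a b where b: "b \<noteq> 0" "coprime b (int p)" "x = of_int a / of_int b" by blast
  obtain c d where cd: "quotient_of x = (c, d)" by fastforce
  have d: "d > 0" "coprime c d" using quotient_of_denom_pos[OF cd] quotient_of_coprime[OF cd] by auto
  have "(of_int (a * d) :: rat) = of_int (c * b)"
    using b d quotient_of_div[OF cd] by (simp add: field_simps)
  hence "a * d = c * b" by (rule of_int_eq_iff[THEN iffD1])
  hence "d dvd c * b" by (metis dvd_triv_right)
  hence "d dvd b" using d(2) by (metis coprime_commute coprime_dvd_mult_right_iff)
  hence "coprime d (int p)" using coprime_divisors[OF _ dvd_refl b(2)] by simp
  thus "p_integral p x" by (simp add: p_integral_def cd)
qed

lemma p_integral_of_int [simp]: "p_integral p (of_int a)"
  unfolding p_integral_iff by (rule exI[of _ a], rule exI[of _ 1]) simp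

lemma p_integral_add [intro]:
  assumes "p_integral p x" "p_integral p y" shows "p_integral p (x + y)"
proof -
  obtain a b c d where "b \<noteq> 0" "coprime b (int p)" "x = of_int a / of_int b"
    "d \<noteq> 0" "coprime d (int p)" "y = of_int c / of_int d" using assms unfolding p_integral_iff by blast
  thus ?thesis unfolding p_integral_iff
    by (intro exI[of _ "a * d + c * b"] exI[of _ "b * d"]) (simp add: field_simps)
qed

lemma p_integral_mult [intro]:
  assumes "p_integral p x" "p_integral p y" shows "p_integral p (x * y)"
proof -
  obtain a b c d where "b \<noteq> 0" "coprime b (int p)" "x = of_int a / of_int b"
    "d \<noteq> 0" "coprime d (int p)" "y = of_int c / of_int d" using assms unfolding p_integral_iff by blast
  thus ?thesis unfolding p_integral_iff
    by (intro exI[of _ "a * c"] exI[of _ "b * d"]) (simp add: field_simps)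
qed

text \<open>Divisibility by \<open>p ^ n\<close> inside the ring of \<open>p\<close>-integral
  rationals. Since \<open>pdiv p 0\<close> is integrality itself, integrality and congruences share
  one set of rules.\<close>

definition pdiv :: "nat \<Rightarrow> nat \<Rightarrow> rat \<Rightarrow> bool"
  where "pdiv p n x \<longleftrightarrow> (\<exists>r. p_integral p r \<and> x = of_nat p ^ n * r)"

lemma pdiv_0_iff: "pdiv p 0 x \<longleftrightarrow> p_integral p x"
  by (simp add: pdiv_def)

lemma pdiv_add: "pdiv p n x \<Longrightarrow> pdiv p n y \<Longrightarrow> pdiv p n (x + y)"
  unfolding pdiv_def by (metis distrib_left p_integral_add)

lemma pdiv_mult: "pdiv p i x \<Longrightarrow> pdiv p j y \<Longrightarrow> pdiv p (i + j) (x * y)"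
proof -
  assume "pdiv p i x" "pdiv p j y"
  then obtain r s where "p_integral p r" "x = of_nat p ^ i * r" "p_integral p s" "y = of_nat p ^ j * s"
    unfolding pdiv_def by blast
  thus ?thesis unfolding pdiv_def by (intro exI[of _ "r * s"]) (auto simp: power_add)
qed

lemma pdiv_of_int_power: "int p ^ n dvd a \<Longrightarrow> pdiv p n (of_int a)"
proof -
  assume "int p ^ n dvd a"
  then obtain k where "a = int p ^ n * k" by (elim dvdE)
  thus ?thesis unfolding pdiv_def by (intro exI[of _ "of_int k"]) simp
qed

lemma pdiv_of_int [simp]: "pdiv p 0 (of_int a)"
  by (simp add: pdiv_0_iff)

lemma pdiv_of_nat [simp]: "pdiv p 0 (of_nat a)"
  using pdiv_of_int[of p "int a"] by simp

lemma pdiv_numeral [simp]: "pdiv p 0 (numeral a)"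
  using pdiv_of_nat[of p "numeral a"] by simp

lemma pdiv_1 [simp]: "pdiv p 0 1"
  using pdiv_of_nat[of p 1] by simp

lemma pdiv_zero [simp]: "pdiv p n 0"
  using pdiv_of_int_power[of p n 0] by simp

lemma pdiv_mult_left: "pdiv p n x \<Longrightarrow> pdiv p 0 y \<Longrightarrow> pdiv p n (y * x)"
  using pdiv_mult[of p 0 y n x] by simp

lemma pdiv_mult_right: "pdiv p n x \<Longrightarrow> pdiv p 0 y \<Longrightarrow> pdiv p n (x * y)"
  using pdiv_mult[of p n x 0 y] by simp

lemma pdiv_uminus: "pdiv p n x \<Longrightarrow> pdiv p n (- x)"
  using pdiv_mult_left[of p n x "of_int (-1)"] by (simp del: of_int_minus) simp

lemma pdiv_diff: "pdiv p n x \<Longrightarrow> pdiv p n y \<Longrightarrow> pdiv p n (x - y)"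
  using pdiv_add[of p n x "- y"] pdiv_uminus by simp

lemma pdiv_mono: "pdiv p n x \<Longrightarrow> k \<le> n \<Longrightarrow> pdiv p k x"
proof -
  assume "pdiv p n x" "k \<le> n"
  then obtain r where "p_integral p r" "x = of_nat p ^ n * r" unfolding pdiv_def by blast
  thus ?thesis unfolding pdiv_def using \<open>k \<le> n\<close>
    using p_integral_mult[OF p_integral_of_int[of p "int (p ^ (n - k))"], of r]
    by (intro exI[of _ "of_int (int (p ^ (n - k))) * r"])
       (simp add: mult.assoc [symmetric] power_add [symmetric])
qed

lemma pdiv_power: "pdiv p 0 x \<Longrightarrow> pdiv p 0 (x ^ n)"
  by (induction n) (use pdiv_mult_left in auto)

lemma pdiv_sum: "(\<And>i. i \<in> A \<Longrightarrow> pdiv p n (g i)) \<Longrightarrow> pdiv p n (sum g A)"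
  by (induction A rule: infinite_finite_induct) (auto simp: pdiv_add)

lemma pdiv_inverse_of_int:
  assumes "coprime a (int p)" "a \<noteq> 0" shows "pdiv p 0 (1 / of_int a)"
  unfolding pdiv_0_iff p_integral_iff using assms by (intro exI[of _ 1] exI[of _ a]) simp

lemma pdiv_inverse_of_nat:
  assumes "coprime a p" "a \<noteq> 0" shows "pdiv p 0 (1 / of_nat a)"
  using pdiv_inverse_of_int[of "int a" p] assms by simp

lemma pdiv_trans: "pdiv p n (x - y) \<Longrightarrow> pdiv p n (y - z) \<Longrightarrow> pdiv p n (x - z)"
  using pdiv_add[of p n "x - y" "y - z"] by simp

lemma pdiv_sym: "pdiv p n (x - y) \<Longrightarrow> pdiv p n (y - x)"
  using pdiv_uminus[of p n "x - y"] by simp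

text \<open>The difference passes through the mixed product of \<open>x'\<close> and
  \<open>y\<close>, which is why integrality is asked of these two.\<close>

lemma pdiv_diff_mult:
  assumes "pdiv p n (x - x')" "pdiv p n (y - y')" "pdiv p 0 x'" "pdiv p 0 y"
  shows "pdiv p n (x * y - x' * y')"
proof -
  have "x * y - x' * y' = (x - x') * y + x' * (y - y')" by (simp add: algebra_simps)
  thus ?thesis using assms by (auto intro: pdiv_add pdiv_mult_left pdiv_mult_right)
qed

lemma pdiv_diff_power2:
  assumes "pdiv p n (x - y)" "pdiv p 0 x" "pdiv p 0 y"
  shows "pdiv p n (x\<^sup>2 - y\<^sup>2)"
  using pdiv_diff_mult[OF assms(1) assms(1)] assms by (simp add: power2_eq_square)

lemma pdiv_diff_sum:
  "(\<And>i. i \<in> A \<Longrightarrow> pdiv p n (g i - h i)) \<Longrightarrow> pdiv p n (sum g A - sum h A)"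
  by (simp add: sum_subtractf [symmetric] pdiv_sum)

lemma rat_congI: "pdiv p n (x - y) \<Longrightarrow> pdiv p 0 y \<Longrightarrow> rat_cong x y p n"
  using pdiv_mono[of p n "x - y" 0] pdiv_add[of p 0 "x - y" y]
  by (auto simp: rat_cong_def pdiv_0_iff pdiv_def)

section \<open>The deformed sum\<close>

text \<open>\<^term>\<open>trunc_sum N X\<close> is \<open>4\<^sup>N N!\<^sup>2 S\<^sub>N(X)\<close>, scaled so that it makes sense in every commutative ring.\<close>

fun odd_prod :: "nat \<Rightarrow> 'a :: comm_ring_1 \<Rightarrow> 'a" where
  "odd_prod 0 X = 1"
| "odd_prod (Suc N) X = odd_prod N X * ((2 * of_nat N + 1)\<^sup>2 - X\<^sup>2)"

fun trunc_sum :: "nat \<Rightarrow> 'a :: comm_ring_1 \<Rightarrow> 'a" where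
  "trunc_sum 0 X = 1"
| "trunc_sum (Suc N) X = 4 * (of_nat (Suc N))\<^sup>2 * trunc_sum N X + odd_prod (Suc N) X"

text \<open>The common factor of \<open>odd_prod (Suc N)\<close> at \<open>X\<close> and at
  \<open>X - 2\<close>: after the shift, all but one factor of each of the two linear chains
  reappear.\<close>

definition chain_prod :: "nat \<Rightarrow> 'a :: comm_ring_1 \<Rightarrow> 'a" where
  "chain_prod N X = (\<Prod>i = 1..N. (2 * of_nat i - 1 + X) * (2 * of_nat i + 1 - X))"

lemma chain_prod_Suc: "chain_prod (Suc N) X = chain_prod N X * ((2 * of_nat N + 1 + X) * (2 * of_nat N + 3 - X))"
  by (simp add: chain_prod_def algebra_simps)

lemma odd_prod_Suc_eq_chain_prod: "odd_prod (Suc N) X = chain_prod N X * ((2 * of_nat N + 1 + X) * (1 - X))"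
  by (induction N) (simp_all add: chain_prod_Suc, simp_all add: chain_prod_def power2_eq_square algebra_simps)

lemma odd_prod_Suc_shift_eq_chain_prod: "odd_prod (Suc N) (X - 2) = chain_prod N X * ((X - 1) * (2 * of_nat N + 3 - X))"
  by (induction N) (simp_all add: chain_prod_Suc, simp_all add: chain_prod_def power2_eq_square algebra_simps)

text \<open>In the step the two \<open>odd_prod\<close> terms contribute -2(X - 1)^2 beside the
  common factor \<open>chain_prod N X\<close>, and 4(N + 1)^2 - (X - 1)^2 factors as (2N + 1 + X)(2N
  + 3 - X).\<close>

lemma trunc_sum_chain: "trunc_sum N X + trunc_sum N (X - 2) = 2 * chain_prod N X"
proof (induction N)
  case 0
  thus ?case by (simp add: chain_prod_def)
next
  case (Suc N)
  have "trunc_sum (Suc N) X + trunc_sum (Suc N) (X - 2) =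
      4 * (of_nat (Suc N))\<^sup>2 * (trunc_sum N X + trunc_sum N (X - 2)) + (odd_prod (Suc N) X + odd_prod (Suc N) (X - 2))"
    by (simp add: algebra_simps)
  also have "\<dots> = 2 * chain_prod (Suc N) X"
    unfolding Suc odd_prod_Suc_shift_eq_chain_prod unfolding odd_prod_Suc_eq_chain_prod chain_prod_Suc
    by (simp add: power2_eq_square algebra_simps)
  finally show ?case .
qed

lemma odd_prod_minus: "odd_prod N (- X) = odd_prod N X"
  by (induction N) simp_all

lemma trunc_sum_minus: "trunc_sum N (- X) = trunc_sum N X"
  by (induction N) (simp_all add: odd_prod_minus)

lemma chain_prod_one: "chain_prod N (1 :: 'a :: {comm_ring_1, ring_char_0, idom}) = 4 ^ N * (fact N)\<^sup>2"
  by (induction N) (simp_all add: chain_prod_Suc, simp_all add: chain_prod_def power2_eq_square algebra_simps)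

text \<open>The chain relation at X = 1 links the values at 1 and -1, which agree because the sum is
  even in X.\<close>

lemma trunc_sum_one: "trunc_sum N (1 :: 'a :: {comm_ring_1, ring_char_0, idom}) = 4 ^ N * (fact N)\<^sup>2"
proof -
  have "trunc_sum N (1 :: 'a) + trunc_sum N (1 - 2) = 2 * trunc_sum N 1"
    using trunc_sum_minus[of N "1 :: 'a"] by simp
  thus ?thesis using trunc_sum_chain[of N "1 :: 'a"] chain_prod_one[of N, where ?'a = 'a] by simp
qed

text \<open>At X = 2j + 1 with 1 <= j <= N the factor 2i + 1 - X of \<open>chain_prod\<close>
  vanishes for i = j, so consecutive odd arguments give opposite values.\<close>

lemma trunc_sum_odd:
  assumes "j \<le> N"
  shows "trunc_sum N (2 * of_nat j + 1 :: 'a :: {comm_ring_1, ring_char_0, idom}) = (-1) ^ j * (4 ^ N * (fact N)\<^sup>2)"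
  using assms
proof (induction j)
  case 0
  thus ?case by (simp add: trunc_sum_one)
next
  case (Suc j)
  have "chain_prod N (2 * of_nat (Suc j) + 1 :: 'a) = 0"
    unfolding chain_prod_def using Suc.prems by (intro prod_zero bexI[of _ "Suc j"]) auto
  hence "trunc_sum N (2 * of_nat (Suc j) + 1 :: 'a) = - trunc_sum N (2 * of_nat j + 1)"
    using trunc_sum_chain[of N "2 * of_nat (Suc j) + 1 :: 'a"] by (simp add: algebra_simps eq_neg_iff_add_eq_0)
  thus ?case using Suc by simp
qed

section \<open>Normalised central binomials and the exact values of the deformed sum\<close>

definition cbin :: "nat \<Rightarrow> rat" where
  "cbin k = of_nat ((2 * k) choose k) / 4 ^ k"

lemma cbin_0 [simp]: "cbin 0 = 1"
  by (simp add: cbin_def)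

lemma cbin_Suc: "cbin (Suc k) = cbin k * (of_nat (2 * k + 1) / of_nat (2 * k + 2))"
proof -
  have "(2 * Suc k choose Suc k) * Suc k = 2 * (2 * k + 1) * (2 * k choose k)"
  proof -
    have "Suc k * (Suc (2 * k + 1) choose Suc k) = Suc (2 * k + 1) * ((2 * k + 1) choose k)"
      using Suc_times_binomial_eq[of "2 * k + 1" k] by (simp add: mult.commute)
    moreover have "Suc k * ((2 * k + 1) choose k) = (2 * k + 1) * ((2 * k) choose k)"
      using binomial_absorb_comp[of "2 * k + 1" k] by simp
    ultimately have "Suc k * (Suc k * (2 * Suc k choose Suc k)) = Suc k * (2 * (2 * k + 1) * (2 * k choose k))"
      by (simp add: algebra_simps)
    hence "Suc k * (2 * Suc k choose Suc k) = 2 * (2 * k + 1) * (2 * k choose k)"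
      by (simp only: Suc_mult_cancel1)
    thus ?thesis by (simp only: mult.commute)
  qed
  hence "(of_nat (2 * Suc k choose Suc k) :: rat) * of_nat (Suc k) = of_nat (2 * (2 * k + 1)) * of_nat (2 * k choose k)"
    by (metis of_nat_mult)
  hence eq: "(of_nat (2 * Suc k choose Suc k) :: rat) = of_nat (2 * (2 * k + 1)) * of_nat (2 * k choose k) / of_nat (Suc k)"
    by (metis nonzero_mult_div_cancel_right of_nat_neq_0)
  have "of_nat (2 * (2 * k + 1)) = 2 * (of_nat (2 * k + 1) :: rat)" "of_nat (2 * k + 2) = 2 * (of_nat (Suc k) :: rat)"
    by simp_all
  moreover have "2 * w * c / s / 4 ^ Suc k = c / 4 ^ k * (w / (2 * s))" for w c s :: rat by simp
  ultimately show ?thesis unfolding cbin_def eq by (simp only:)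
qed

lemma cbin_power2: "(of_nat ((2 * k) choose k))\<^sup>2 / 16 ^ k = (cbin k)\<^sup>2"
proof -
  have "(16 :: rat) ^ k = (4 ^ k)\<^sup>2"
    by (simp add: power2_eq_square power_mult_distrib [symmetric])
  thus ?thesis by (simp add: cbin_def power_divide)
qed

definition pert_factor :: "rat \<Rightarrow> nat \<Rightarrow> rat" where
  "pert_factor X k = (\<Prod>j<k. 1 - X\<^sup>2 / (2 * of_nat j + 1)\<^sup>2)"

lemma pert_factor_Suc: "pert_factor X (Suc k) = pert_factor X k * (1 - X\<^sup>2 / (2 * of_nat k + 1)\<^sup>2)"
  by (simp add: pert_factor_def)

text \<open>\<open>cbin k\<close> is the product of the ratios (2j + 1)/(2j + 2), hence
  \<open>4 ^ k * (fact k)\<^sup>2 * (cbin k)\<^sup>2\<close> is the product of the (2j + 1)^2;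
  \<open>pert_factor\<close> restores the dependence on X.\<close>

lemma odd_prod_eq_cbin: "odd_prod k (X :: rat) = 4 ^ k * (fact k)\<^sup>2 * ((cbin k)\<^sup>2 * pert_factor X k)"
proof (induction k)
  case (Suc k)
  define u v :: rat where "u = 2 * of_nat k + 1" and "v = of_nat k + 1"
  have nz: "u \<noteq> 0" "v \<noteq> 0" unfolding u_def v_def
    using of_nat_neq_0[of "2 * k", where ?'a = rat] of_nat_neq_0[of k, where ?'a = rat]
    by (simp_all add: add.commute)
  have key: "u\<^sup>2 - X\<^sup>2 = 4 * v\<^sup>2 * (u / (2 * v))\<^sup>2 * (1 - X\<^sup>2 / u\<^sup>2)"
    using nz by (simp add: field_simps power2_eq_square)
  have "odd_prod (Suc k) X = 4 ^ k * (fact k)\<^sup>2 * ((cbin k)\<^sup>2 * pert_factor X k) * (u\<^sup>2 - X\<^sup>2)"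
    by (simp add: Suc u_def)
  also have "\<dots> = 4 ^ Suc k * (v * fact k)\<^sup>2 * ((cbin k * (u / (2 * v)))\<^sup>2 * (pert_factor X k * (1 - X\<^sup>2 / u\<^sup>2)))"
    unfolding key by (simp add: power_mult_distrib del: times_divide_eq_right)
  also have "\<dots> = 4 ^ Suc k * (fact (Suc k))\<^sup>2 * ((cbin (Suc k))\<^sup>2 * pert_factor X (Suc k))"
    unfolding cbin_Suc pert_factor_Suc by (simp add: u_def v_def algebra_simps)
  finally show ?case .
qed (simp add: pert_factor_def)

lemma trunc_sum_eq_cbin: "trunc_sum N (X :: rat) = 4 ^ N * (fact N)\<^sup>2 * (\<Sum>k\<le>N. (cbin k)\<^sup>2 * pert_factor X k)"
proof (induction N)
  case (Suc N)
  show ?case unfolding trunc_sum.simps Suc odd_prod_eq_cbin by (simp add: power2_eq_square algebra_simps)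
qed (simp add: pert_factor_def)

lemma pert_factor_0 [simp]: "pert_factor 0 k = 1"
  by (simp add: pert_factor_def)

text \<open>An exact identity over the rationals. Choosing j so that 2j + 1 is p or a power of p
  makes it the source of the congruences below.\<close>

lemma sum_cbin_pert_factor:
  assumes "j \<le> N"
  shows "(\<Sum>k\<le>N. (cbin k)\<^sup>2 * pert_factor (2 * of_nat j + 1) k) = (-1) ^ j"
  using trunc_sum_odd[OF assms, where ?'a = rat] unfolding trunc_sum_eq_cbin by simp

section \<open>Reduction of the telescoped products modulo a prime\<close>

text \<open>Lagrange's bound on roots modulo a prime, phrased over the integers: divisibility by the
  constant polynomial means that every coefficient is divisible by q. Each root is split off by
  synthetic division.\<close>

lemma const_dvd_of_many_roots:
  fixes h :: "int poly" and q :: int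
  assumes "prime q" "finite A" "h = 0 \<or> degree h < card A"
    and "\<And>a. a \<in> A \<Longrightarrow> q dvd poly h a"
    and "\<And>a b. a \<in> A \<Longrightarrow> b \<in> A \<Longrightarrow> a \<noteq> b \<Longrightarrow> \<not> q dvd a - b"
  shows "[:q:] dvd h"
  using assms(2-)
proof (induction A arbitrary: h rule: finite_induct)
  case empty
  thus ?case by simp
next
  case (insert a A)
  define g where "g = synthetic_div h a"
  have h: "h = [:-a, 1:] * g + [:poly h a:]" unfolding g_def by (rule synthetic_div_correct' [symmetric])
  have "[:q:] dvd g"
  proof (rule insert.IH)
    show "g = 0 \<or> degree g < card A"
      using insert.prems(1) insert.hyps
      by (cases "degree h = 0") (auto simp: g_def synthetic_div_eq_0_iff degree_synthetic_div)
    fix b assume b: "b \<in> A"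
    have "poly h b = (b - a) * poly g b + poly h a" by (subst h) (simp add: algebra_simps)
    hence "q dvd (b - a) * poly g b"
      using insert.prems(2)[of a] insert.prems(2)[of b] b by (metis dvd_add_left_iff insertCI)
    moreover have "\<not> q dvd b - a" using insert.prems(3)[of b a] b insert.hyps by auto
    ultimately show "q dvd poly g b" using \<open>prime q\<close> prime_dvd_mult_iff by blast
  qed (use insert.prems(3) in auto)
  moreover have "[:q:] dvd [:poly h a:]" using insert.prems(2)[of a] by simp
  ultimately show ?case by (subst h) (intro dvd_add dvd_mult)
qed

lemma dvd_diff_mult_mult:
  fixes d :: "'a :: comm_ring_1"
  assumes "d dvd a - b" "d dvd a' - b'" shows "d dvd a * a' - b * b'"
proof -
  have "a * a' - b * b' = (a - b) * a' + b * (a' - b')" by (simp add: algebra_simps)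
  thus ?thesis using assms by simp
qed

lemma fermat_int:
  fixes b :: int
  assumes p: "prime p" and "\<not> int p dvd b" shows "int p dvd b ^ (p - 1) - 1"
proof -
  have cong: "[b = int (nat (b mod int p))] (mod int p)"
    using prime_gt_0_nat[OF p] by (simp add: cong_def)
  have "\<not> int p dvd int (nat (b mod int p))"
    using assms(2) cong_dvd_iff[OF cong] by (metis cong cong_def dvd_eq_mod_eq_0)
  hence "\<not> p dvd nat (b mod int p)" by (simp only: int_dvd_int_iff not_False_eq_True)
  from fermat_theorem[OF p this] have "[int (nat (b mod int p)) ^ (p - 1) = 1] (mod int p)"
    by (metis cong_int_iff of_nat_1 of_nat_power)
  thus ?thesis using cong_pow[OF cong, of "p - 1"] cong_trans cong_iff_dvd_diff by blast
qed

text \<open>With Z = T + c, this is the factorisation of Z^(p-1) - 1 over the nonzero residues. Both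
  sides are monic of degree p - 1, so their difference has smaller degree but p - 1 roots a - c
  modulo p.\<close>

lemma nonzero_residues_prod_poly:
  fixes p :: nat and A :: "int set"
  assumes p: "prime p" and A: "finite A" "card A = p - 1"
    and nz: "\<And>a. a \<in> A \<Longrightarrow> \<not> int p dvd a"
    and inc: "\<And>a b. a \<in> A \<Longrightarrow> b \<in> A \<Longrightarrow> a \<noteq> b \<Longrightarrow> \<not> int p dvd a - b"
  shows "[:int p:] dvd (\<Prod>a\<in>A. [:c - a, 1:]) - ([:c, 1:] ^ (p - 1) - 1)"
proof -
  define P where "P = (\<Prod>a\<in>A. [:c - a, 1:])"
  define h where "h = P - ([:c, 1:] ^ (p - 1) - 1)"
  have p1: "p - 1 > 0" using prime_gt_1_nat[OF p] by simp
  have degP: "degree P = p - 1" unfolding P_def using A by (subst degree_prod_eq_sum_degree) auto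
  have degM: "degree ([:c, 1:] ^ (p - 1)) = p - 1" by (simp add: degree_power_eq)
  have "coeff P (p - 1) = 1"
    using lead_coeff_prod[of "\<lambda>a. [:c - a, 1:]" A] degP unfolding P_def by simp
  moreover have "coeff ([:c, 1:] ^ (p - 1)) (p - 1) = 1" by (rule coeff_linear_power)
  ultimately have c0: "coeff h (p - 1) = 0" using p1 by (simp add: h_def)
  have "degree h \<le> p - 1" unfolding h_def
    by (intro degree_diff_le; use degP degM in simp)
  hence deg: "h = 0 \<or> degree h < p - 1"
    using c0 by (metis leading_coeff_0_iff nat_less_le)
  have "[:int p:] dvd h"
  proof (rule const_dvd_of_many_roots[where A = "(\<lambda>a. a - c) ` A"])
    show "h = 0 \<or> degree h < card ((\<lambda>a. a - c) ` A)"
      using deg A by (simp add: card_image)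
    fix a assume "a \<in> (\<lambda>a. a - c) ` A"
    then obtain b where b: "b \<in> A" "a = b - c" by blast
    have "poly P a = 0" unfolding P_def poly_prod using A b by (intro prod_zero) auto
    thus "int p dvd poly h a"
      using fermat_int[OF p nz[OF b(1)]] b by (simp add: h_def dvd_diff_commute)
  qed (use p A inc in auto)
  thus ?thesis by (simp add: h_def P_def)
qed

text \<open>With Z = X - 1 the factors of \<open>chain_prod\<close> are Z + 2i and -(Z -
  2i).\<close>

lemma chain_prod_shift:
  "chain_prod N [:x, 1:] = (\<Prod>i = 1..N. [:(x - 1) - (- 2 * int i), 1:]) * ((-1) ^ N * (\<Prod>i = 1..N. [:(x - 1) - 2 * int i, 1:]))"
proof -
  have "(-1) ^ N * (\<Prod>i = 1..N. [:(x - 1) - 2 * int i, 1:]) = (\<Prod>i = 1..N. - [:(x - 1) - 2 * int i, 1:])"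
    by (simp only: prod_uminus card_atLeastAtMost diff_Suc_1)
  thus ?thesis unfolding chain_prod_def
    by (simp only: prod.distrib [symmetric])
       (intro prod.cong, simp_all add: of_nat_poly numeral_poly one_pCons algebra_simps)
qed

lemma not_dvd_of_small: "a \<noteq> 0 \<Longrightarrow> \<bar>a\<bar> < int p \<Longrightarrow> \<not> int p dvd a"
  using zdvd_not_zless[of "\<bar>a\<bar>" "int p"] by simp

lemma not_dvd_double_of_small:
  assumes "prime p" "odd p" "a \<noteq> 0" "\<bar>a\<bar> < int p" shows "\<not> int p dvd 2 * a"
proof
  assume "int p dvd 2 * a"
  hence "int p dvd 2 \<or> int p dvd a" using assms(1) prime_dvd_mult_iff[of "int p" 2 a] by simp
  moreover have "\<not> int p dvd 2"
    using assms prime_gt_1_nat[OF assms(1)] by (intro not_dvd_of_small) (auto simp: odd_pos elim: oddE)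
  ultimately show False using not_dvd_of_small assms by blast
qed

text \<open>For 1 <= i <= p - 1 the numbers 2i exhaust the nonzero residues, and so do the numbers
  -2i; hence the square. The two choices of \<open>s\<close> treat both signs at once.\<close>

lemma chain_prod_mod_full:
  assumes p: "prime p" "odd p"
  shows "[:int p:] dvd chain_prod (p - 1) [:x, 1:] - ([:x - 1, 1:] ^ (p - 1) - 1)\<^sup>2"
proof -
  have main: "[:int p:] dvd (\<Prod>i = 1..p-1. [:(x - 1) - s * (2 * int i), 1:]) - ([:x - 1, 1:] ^ (p - 1) - 1)"
    if s: "s = 1 \<or> s = -1" for s
  proof -
    have inj: "inj_on (\<lambda>i. s * (2 * int i)) {1..p-1}" using s by (auto simp: inj_on_def)
    have "(\<Prod>i = 1..p-1. [:(x - 1) - s * (2 * int i), 1:]) =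
        (\<Prod>a\<in>(\<lambda>i. s * (2 * int i)) ` {1..p-1}. [:(x - 1) - a, 1:])"
      by (subst prod.reindex[OF inj]) (simp add: o_def)
    also have "[:int p:] dvd \<dots> - ([:x - 1, 1:] ^ (p - 1) - 1)"
    proof (rule nonzero_residues_prod_poly)
      fix a assume "a \<in> (\<lambda>i. s * (2 * int i)) ` {1..p-1}"
      then obtain i where i: "i \<in> {1..p-1}" "a = s * (2 * int i)" by blast
      thus "\<not> int p dvd a" using not_dvd_double_of_small[OF p, of "s * int i"] s by auto
      fix b assume "b \<in> (\<lambda>i. s * (2 * int i)) ` {1..p-1}" "a \<noteq> b"
      then obtain j where j: "j \<in> {1..p-1}" "b = s * (2 * int j)" by blast
      thus "\<not> int p dvd a - b"
        using not_dvd_double_of_small[OF p, of "s * (int i - int j)"] s i \<open>a \<noteq> b\<close>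
        by (auto simp: algebra_simps)
    qed (use p inj in \<open>auto simp: card_image\<close>)
    finally show ?thesis .
  qed
  have "(-1) ^ (p - 1) = (1 :: int poly)" using p by simp
  thus ?thesis
    using dvd_diff_mult_mult[OF main[of "-1"] main[of 1]] unfolding chain_prod_shift power2_eq_square by simp
qed

text \<open>For 1 <= i <= m the numbers 2i and -2i only together form one system of nonzero
  residues, so Z^(p-1) - 1 occurs once, and the sign (-1)^m survives.\<close>

lemma chain_prod_mod_half:
  assumes p: "prime p" "p = 2 * m + 1"
  shows "[:int p:] dvd chain_prod m [:x, 1:] - (-1) ^ m * ([:x - 1, 1:] ^ (p - 1) - 1)"
proof -
  let ?A = "(\<lambda>i. - 2 * int i) ` {1..m}" and ?B = "(\<lambda>i. 2 * int i) ` {1..m}"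
  have odd: "odd p" using p by simp
  have inj: "inj_on (\<lambda>i. - 2 * int i) {1..m}" "inj_on (\<lambda>i. 2 * int i) {1..m}"
    by (auto simp: inj_on_def)
  have disj: "?A \<inter> ?B = {}" by auto
  have "chain_prod m [:x, 1:] = (-1) ^ m * (\<Prod>a\<in>?A \<union> ?B. [:(x - 1) - a, 1:])"
  proof -
    have "(\<Prod>a\<in>?A. [:(x - 1) - a, 1:]) = (\<Prod>i = 1..m. [:(x - 1) - (- 2 * int i), 1:])"
      by (subst prod.reindex[OF inj(1)]) (simp add: o_def)
    moreover have "(\<Prod>a\<in>?B. [:(x - 1) - a, 1:]) = (\<Prod>i = 1..m. [:(x - 1) - 2 * int i, 1:])"
      by (subst prod.reindex[OF inj(2)]) (simp add: o_def)
    ultimately show ?thesis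
      unfolding chain_prod_shift by (subst prod.union_disjoint[OF _ _ disj]) (simp_all only: finite_imageI finite_atLeastAtMost mult_ac)
  qed
  moreover have "[:int p:] dvd (\<Prod>a\<in>?A \<union> ?B. [:(x - 1) - a, 1:]) - ([:x - 1, 1:] ^ (p - 1) - 1)"
  proof (rule nonzero_residues_prod_poly[OF p(1)])
    show "card (?A \<union> ?B) = p - 1"
    proof -
      have "card (?A \<union> ?B) = card ?A + card ?B" by (rule card_Un_disjoint[OF _ _ disj]) auto
      also have "\<dots> = m + m" by (simp only: card_image[OF inj(1)] card_image[OF inj(2)]) simp
      finally show ?thesis using p(2) by linarith
    qed
    fix a assume a: "a \<in> ?A \<union> ?B"
    \<comment> \<open>Both halves are written as 2i with 0 < |i| <= m, so that a difference is twice
      an integer of absolute value at most 2m < p.\<close>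
    have mem: "\<exists>i. a = 2 * i \<and> i \<noteq> 0 \<and> \<bar>i\<bar> \<le> int m" if "a \<in> ?A \<union> ?B" for a
      using that
    proof
      assume "a \<in> ?A"
      then obtain i where "a = - 2 * int i" "i \<in> {1..m}" by blast
      thus ?thesis by (intro exI[of _ "- int i"]) auto
    next
      assume "a \<in> ?B"
      then obtain i where "a = 2 * int i" "i \<in> {1..m}" by blast
      thus ?thesis by (intro exI[of _ "int i"]) auto
    qed
    from mem[OF a] obtain i where i: "a = 2 * i" "i \<noteq> 0" "\<bar>i\<bar> \<le> int m" by blast
    have "\<bar>i\<bar> < int p" using i(3) p(2) by linarith
    thus "\<not> int p dvd a" using not_dvd_double_of_small[OF p(1) odd i(2)] i(1) by simp
    fix b assume b: "b \<in> ?A \<union> ?B" "a \<noteq> b"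
    from mem[OF b(1)] obtain j where j: "b = 2 * j" "\<bar>j\<bar> \<le> int m" by blast
    have "\<bar>i - j\<bar> < int p" "i - j \<noteq> 0" using i j p(2) b(2) by linarith+
    from not_dvd_double_of_small[OF p(1) odd this(2,1)] show "\<not> int p dvd a - b"
      using i j by (simp add: right_diff_distrib)
  qed simp
  hence "[:int p:] dvd (-1) ^ m * ((\<Prod>a\<in>?A \<union> ?B. [:(x - 1) - a, 1:]) - ([:x - 1, 1:] ^ (p - 1) - 1))"
    by (rule dvd_mult)
  ultimately show ?thesis by (simp only: right_diff_distrib)
qed

section \<open>Quadratic Taylor coefficients of the deformed sum\<close>

lemma trunc_sum_pcompose: "pcompose (trunc_sum N X) q = trunc_sum N (pcompose X q :: int poly)"
proof -
  have "pcompose (odd_prod N X) q = odd_prod N (pcompose X q)" for N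
    by (induction N) (simp_all add: pcompose_mult pcompose_diff pcompose_add pcompose_1 power2_eq_square of_nat_poly numeral_poly)
  thus ?thesis
    by (induction N) (simp_all add: pcompose_mult pcompose_diff pcompose_add pcompose_1 pcompose_smult power2_eq_square of_nat_poly numeral_poly
        del: odd_prod.simps)
qed

lemma poly_trunc_sum: "poly (trunc_sum N X) z = trunc_sum N (poly X z :: int)"
proof -
  have "poly (odd_prod N X) z = odd_prod N (poly X z)" for N
    by (induction N) simp_all
  thus ?thesis by (induction N) (simp_all del: odd_prod.simps)
qed

lemma of_int_trunc_sum: "of_int (trunc_sum N x) = (trunc_sum N (of_int x) :: rat)"
proof -
  have "of_int (odd_prod N x) = (odd_prod N (of_int x) :: rat)" for N
    by (induction N) simp_all
  thus ?thesis by (induction N) (simp_all del: odd_prod.simps)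
qed

lemma trunc_sum_cong_dvd:
  assumes "d dvd X - Y" shows "d dvd trunc_sum N X - trunc_sum N Y"
proof -
  have "d dvd odd_prod N X - odd_prod N Y" for N
  proof (induction N)
    case (Suc N)
    have "d dvd X\<^sup>2 - Y\<^sup>2" unfolding power2_eq_square by (rule dvd_diff_mult_mult[OF assms assms])
    hence "d dvd ((2 * of_nat N + 1)\<^sup>2 - X\<^sup>2) - ((2 * of_nat N + 1)\<^sup>2 - Y\<^sup>2)"
      using dvd_minus_iff[of d "X\<^sup>2 - Y\<^sup>2"] by simp
    from dvd_diff_mult_mult[OF Suc this] show ?case by simp
  qed simp
  note odd_prod = this
  show ?thesis
  proof (induction N)
    case (Suc N)
    have "trunc_sum (Suc N) X - trunc_sum (Suc N) Y =
        4 * (of_nat (Suc N))\<^sup>2 * (trunc_sum N X - trunc_sum N Y) + (odd_prod (Suc N) X - odd_prod (Suc N) Y)"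
      by (simp add: algebra_simps)
    thus ?case using Suc odd_prod by (metis dvd_add dvd_mult)
  qed simp
qed

text \<open>By evenness, the expansion at -x in t is the expansion at x in -t.\<close>

lemma coeff_trunc_sum_neg: "coeff (trunc_sum N [:- x, 1 :: int:]) i = (-1) ^ i * coeff (trunc_sum N [:x, 1:]) i"
proof -
  have "trunc_sum N [:- x, 1 :: int:] = trunc_sum N (- [:- x, 1:])" by (rule trunc_sum_minus [symmetric])
  also have "- [:- x, 1:] = pcompose [:x, 1 :: int:] [:0, -1:]" by (simp add: pcompose_pCons)
  also have "trunc_sum N \<dots> = pcompose (trunc_sum N [:x, 1:]) [:0, -1:]" by (rule trunc_sum_pcompose [symmetric])
  finally show ?thesis by (simp only: coeff_pcompose_linear)
qed

text \<open>Half the second derivative of \<^term>\<open>trunc_sum N\<close> at \<^term>\<open>x\<close>, read off from the expansion at \<open>x + t\<close>.\<close>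

definition quad_coeff :: "nat \<Rightarrow> int \<Rightarrow> int" where
  "quad_coeff N x = coeff (trunc_sum N [:x, 1:]) 2"

lemma quad_coeff_neg: "quad_coeff N (- x) = quad_coeff N x"
  by (simp add: quad_coeff_def coeff_trunc_sum_neg)

lemma quad_coeff_chain: "quad_coeff N x + quad_coeff N (x - 2) = 2 * coeff (chain_prod N [:x, 1:]) 2"
proof -
  have "[:x, 1:] - 2 = [:x - 2, 1:]" by (simp add: numeral_poly)
  hence "trunc_sum N [:x, 1:] + trunc_sum N [:x - 2, 1:] = [:2:] * chain_prod N [:x, 1:]"
    using trunc_sum_chain[of N "[:x, 1:]"] by (simp add: numeral_poly)
  hence "coeff (trunc_sum N [:x, 1:] + trunc_sum N [:x - 2, 1:]) 2 = coeff ([:2:] * chain_prod N [:x, 1:]) 2" by simp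
  thus ?thesis by (simp add: quad_coeff_def)
qed

lemma quad_coeff_cong: "int p dvd x - y \<Longrightarrow> int p dvd quad_coeff N x - quad_coeff N y"
proof -
  assume "int p dvd x - y"
  hence "[:int p:] dvd [:x, 1:] - [:y, 1:]" by simp
  hence "[:int p:] dvd trunc_sum N [:x, 1:] - trunc_sum N [:y, 1:]" by (rule trunc_sum_cong_dvd)
  thus ?thesis unfolding quad_coeff_def const_poly_dvd_iff by (metis coeff_diff)
qed

text \<open>Evenness kills the linear coefficient at 0, and everything beyond the quadratic term
  carries p^3.\<close>

lemma trunc_sum_taylor: "int p ^ 3 dvd trunc_sum N (int p) - trunc_sum N 0 - int p ^ 2 * quad_coeff N 0"
proof -
  define h where "h = trunc_sum N [:0, 1 :: int:]"
  obtain a b c r where h: "h = pCons a (pCons b (pCons c r))" by (metis pCons_cases)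
  have "coeff h 1 = - coeff h 1" using coeff_trunc_sum_neg[of N 0 1] by (simp add: h_def)
  hence b: "b = 0" by (simp add: h)
  have "trunc_sum N (int p) = poly h (int p)" "trunc_sum N 0 = poly h 0" by (simp_all add: h_def poly_trunc_sum)
  moreover have "quad_coeff N 0 = c" by (simp add: quad_coeff_def h_def [symmetric]) (simp add: h numeral_2_eq_2)
  ultimately have "trunc_sum N (int p) - trunc_sum N 0 - int p ^ 2 * quad_coeff N 0 = int p ^ 3 * poly r (int p)"
    by (simp add: h b power2_eq_square power3_eq_cube algebra_simps)
  thus ?thesis by simp
qed

text \<open>Modulo p these are (-1)(-3) and (-1)(-2)/2. They are the binomial coefficients in the
  t^2 terms of Z^(2p-2) and Z^(p-1).\<close>

lemma dvd_choose_two: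
  assumes p: "prime p" "odd p"
  shows "int p dvd int ((2 * p - 2) choose 2) - 3" "int p dvd int ((p - 1) choose 2) - 1"
proof -
  obtain m where m: "p = 2 * m + 1" using p by (elim oddE)
  hence "m > 0" using prime_gt_1_nat[OF p(1)] by simp
  then obtain n where n: "m = Suc n" by (cases m) auto
  have "2 * p - 2 = 2 * (2 * n + 2)" "p - 1 = 2 * (n + 1)" by (simp_all add: m n)
  hence "(2 * p - 2) choose 2 = (2 * n + 2) * (4 * n + 3)" "(p - 1) choose 2 = (n + 1) * (2 * n + 1)"
    by (simp_all only: choose_two) (simp_all add: algebra_simps)
  moreover have "int ((2 * n + 2) * (4 * n + 3)) - 3 = int p * (4 * int n + 1)" "int ((n + 1) * (2 * n + 1)) - 1 = int p * int n"
    by (simp_all add: m n algebra_simps)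
  ultimately show "int p dvd int ((2 * p - 2) choose 2) - 3" "int p dvd int ((p - 1) choose 2) - 1"
    by simp_all
qed

text \<open>With \<open>V = Z\<^sup>p\<^sup>-\<^sup>1\<close>, the combination is \<open>(V - 1)\<^sup>2 - (V - 1)\<close> modulo \<open>p\<close>,
  whose second derivative vanishes at every residue class.\<close>

lemma coeff_chain_prod_combination:
  assumes p: "prime p" "p = 2 * m + 1"
  shows "int p dvd coeff (chain_prod (p - 1) [:x, 1:]) 2 - (-1) ^ m * coeff (chain_prod m [:x, 1:]) 2"
proof -
  have odd: "odd p" using p by simp
  have p3: "p \<ge> 3" using prime_gt_1_nat[OF p(1)] p by simp
  define c where "c = x - 1"
  define V where "V = [:c, 1:] ^ (p - 1)"
  define e :: "int poly" where "e = (-1) ^ m"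
  have ee: "e * e = 1" unfolding e_def by (simp add: power_add [symmetric])
  have c2: "e = [:(-1) ^ m:]" unfolding e_def by (simp add: poly_const_pow [symmetric] one_pCons)
  have "[:int p:] dvd chain_prod (p - 1) [:x, 1:] - (V - 1)\<^sup>2"
    using chain_prod_mod_full[OF p(1) odd] by (simp add: V_def c_def)
  moreover have "[:int p:] dvd e * (chain_prod m [:x, 1:] - e * (V - 1))"
    using chain_prod_mod_half[OF p] by (simp add: V_def c_def e_def)
  hence "[:int p:] dvd e * chain_prod m [:x, 1:] - (V - 1)"
    using ee by (simp add: algebra_simps mult.assoc [symmetric])
  ultimately have "[:int p:] dvd (chain_prod (p - 1) [:x, 1:] - (V - 1)\<^sup>2) - (e * chain_prod m [:x, 1:] - (V - 1))"
    by (rule dvd_diff)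
  \<comment> \<open>Here (V - 1)^2 - (V - 1) = V^2 - 3V + 2; the constant 2 does not reach the
    coefficient of t^2.\<close>
  also have "(chain_prod (p - 1) [:x, 1:] - (V - 1)\<^sup>2) - (e * chain_prod m [:x, 1:] - (V - 1)) =
      (chain_prod (p - 1) [:x, 1:] - e * chain_prod m [:x, 1:]) - ([:c, 1:] ^ (2 * p - 2) - [:3:] * V + [:2:])"
  proof -
    have "[:c, 1:] ^ (2 * p - 2) = V * V" unfolding V_def by (simp flip: power_add mult_2 add: right_diff_distrib')
    moreover have "[:3:] = (3 :: int poly)" "[:2:] = (2 :: int poly)" by (simp_all add: numeral_poly)
    ultimately show ?thesis by (simp only: power2_eq_square) (simp add: algebra_simps)
  qed
  finally have "int p dvd coeff ((chain_prod (p - 1) [:x, 1:] - e * chain_prod m [:x, 1:]) - ([:c, 1:] ^ (2 * p - 2) - [:3:] * V + [:2:])) 2"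
    unfolding const_poly_dvd_iff by blast
  hence 1: "int p dvd (coeff (chain_prod (p - 1) [:x, 1:]) 2 - (-1) ^ m * coeff (chain_prod m [:x, 1:]) 2) -
      (coeff ([:c, 1:] ^ (2 * p - 2)) 2 - 3 * coeff V 2)"
    by (simp add: c2 numeral_2_eq_2)
  have "coeff ([:c, 1:] ^ (2 * p - 2)) 2 = int ((2 * p - 2) choose 2) * c ^ (2 * p - 2 - 2)"
    using p3 by (subst coeff_linear_poly_power) auto
  moreover have "coeff V 2 = int ((p - 1) choose 2) * c ^ (p - 3)"
    using p3 unfolding V_def by (subst coeff_linear_poly_power) (auto simp: diff_diff_eq numeral_eq_Suc)
  moreover have "int p dvd int ((2 * p - 2) choose 2) * c ^ (2 * p - 2 - 2) - 3 * (int ((p - 1) choose 2) * c ^ (p - 3))"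
  proof -
    have "2 * p - 2 - 2 = (p - 3) + (p - 1)" using p3 by simp
    hence "int ((2 * p - 2) choose 2) * c ^ (2 * p - 2 - 2) - 3 * (int ((p - 1) choose 2) * c ^ (p - 3)) =
       (int ((2 * p - 2) choose 2) - 3) * c ^ (2 * p - 2 - 2) - 3 * (int ((p - 1) choose 2) - 1) * c ^ (p - 3)
       + 3 * (c ^ (p - 3) * (c ^ (p - 1) - 1))" by (simp add: algebra_simps power_add)
    \<comment> \<open>If p divides c, the power of c is divisible by p except for p = 3, where the
      exponent is 0; there the factor 3 supplies the divisibility. Otherwise Fermat applies.\<close>
    moreover have "int p dvd 3 * (c ^ (p - 3) * (c ^ (p - 1) - 1))"
    proof (cases "int p dvd c")
      case True
      show ?thesis
      proof (cases "p = 3")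
        case False
        hence "p - 3 > 0" using p3 by simp
        hence "int p dvd c ^ (p - 3)" using True by (simp add: dvd_power_iff_le dvd_trans[OF True] dvd_power)
        thus ?thesis by simp
      qed simp
    next
      case False
      thus ?thesis using fermat_int[OF p(1)] by simp
    qed
    ultimately show ?thesis using dvd_choose_two[OF p(1) odd] by (metis dvd_add dvd_diff dvd_mult dvd_mult2)
  qed
  ultimately have "int p dvd coeff ([:c, 1:] ^ (2 * p - 2)) 2 - 3 * coeff V 2" by simp
  from dvd_add[OF 1 this] show ?thesis by simp
qed

text \<open>The combination changes sign modulo p under a shift by 2 and is even, so at 1 it equals
  its own negative and vanishes. It then vanishes at every odd positive number.\<close>

lemma quad_coeff_combination:
  assumes p: "prime p" "p = 2 * m + 1"
  shows "int p dvd quad_coeff (p - 1) 0 - (-1) ^ m * quad_coeff m 0"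
proof -
  define \<phi> where "\<phi> x = quad_coeff (p - 1) x - (-1) ^ m * quad_coeff m x" for x
  have odd: "odd p" using p by simp
  have step: "int p dvd \<phi> x + \<phi> (x - 2)" for x
  proof -
    have "\<phi> x + \<phi> (x - 2) = (quad_coeff (p - 1) x + quad_coeff (p - 1) (x - 2)) - (-1) ^ m * (quad_coeff m x + quad_coeff m (x - 2))"
      by (simp add: \<phi>_def algebra_simps)
    also have "\<dots> = 2 * (coeff (chain_prod (p - 1) [:x, 1:]) 2 - (-1) ^ m * coeff (chain_prod m [:x, 1:]) 2)"
      unfolding quad_coeff_chain by (simp add: algebra_simps)
    finally show ?thesis using coeff_chain_prod_combination[OF p] by (metis dvd_mult)
  qed
  have odd0: "int p dvd \<phi> (2 * int j + 1)" for j
  proof (induction j)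
    case 0
    have "\<phi> (-1) = \<phi> 1" using quad_coeff_neg[of _ 1] by (simp add: \<phi>_def)
    hence "int p dvd 2 * \<phi> 1" using step[of 1] by simp
    moreover have "coprime (int p) 2" using odd by simp
    ultimately show ?case by (simp add: coprime_dvd_mult_right_iff)
  next
    case (Suc j)
    have "2 * int (Suc j) + 1 - 2 = 2 * int j + 1" by simp
    thus ?case using step[of "2 * int (Suc j) + 1"] Suc by (metis dvd_add_left_iff)
  qed
  \<comment> \<open>Since p is itself odd and congruent to 0, vanishing at odd arguments carries
    over to 0.\<close>
  have "int p dvd \<phi> (int p)" using odd0[of m] by (simp add: p(2) add.commute)
  moreover have "\<phi> (int p) - \<phi> 0 = (quad_coeff (p - 1) (int p) - quad_coeff (p - 1) 0) - (-1) ^ m * (quad_coeff m (int p) - quad_coeff m 0)"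
    by (simp add: \<phi>_def algebra_simps)
  hence "int p dvd \<phi> (int p) - \<phi> 0"
    using quad_coeff_cong[of p "int p" 0] by (simp add: dvd_diff dvd_mult)
  ultimately show ?thesis
    using dvd_diff[of "int p" "\<phi> (int p)" "\<phi> (int p) - \<phi> 0"] by (simp add: \<phi>_def)
qed

section \<open>Evaluation of polynomial divisibility and reindexing of sums\<close>

lemma const_dvd_poly: "[:c:] dvd h \<Longrightarrow> c dvd poly (h :: int poly) x"
  by (auto elim!: dvdE)

text \<open>Reflection turns the last b terms into the first b.\<close>

lemma sum_symmetric_split:
  fixes q :: "nat \<Rightarrow> rat"
  assumes "\<And>i. i < a + b \<Longrightarrow> q (a + b - 1 - i) = q i"
  shows "sum q {..<a + b} = sum q {..<a} + sum q {..<b}"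
proof -
  have "sum q {..<b} = (\<Sum>i<b. q (a + i))"
  proof -
    have "sum q {..<b} = (\<Sum>i<b. q (b - Suc i))" by (rule sum.nat_diff_reindex [symmetric])
    also have "\<dots> = (\<Sum>i<b. q (a + i))"
    proof (rule sum.cong)
      fix i assume "i \<in> {..<b}"
      thus "q (b - Suc i) = q (a + i)" using assms[of "a + i"] by simp
    qed simp
    finally show ?thesis .
  qed
  moreover have "sum q {..<a + b} = sum q {..<a} + (\<Sum>i<b. q (a + i))"
    by (induction b) simp_all
  ultimately show ?thesis by simp
qed

lemma sum_blocks:
  fixes f :: "nat \<Rightarrow> rat"
  assumes "l < q"
  shows "(\<Sum>k\<le>q * t + l. f k) = (\<Sum>k<t. \<Sum>r<q. f (q * k + r)) + (\<Sum>r\<le>l. f (q * t + r))"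
proof -
  have shift: "(\<Sum>k<a + n. f k) = (\<Sum>k<a. f k) + (\<Sum>r<n. f (a + r))" for a n
    by (induction n) simp_all
  have "(\<Sum>k<q * t. f k) = (\<Sum>k<t. \<Sum>r<q. f (q * k + r))"
    by (induction t) (simp_all add: shift add.commute[of q])
  thus ?thesis using shift[of "q * t" "Suc l"] by (simp add: lessThan_Suc_atMost)
qed

section \<open>The case of a prime\<close>

locale odd_prime =
  fixes p m :: nat
  assumes prime_p: "prime p" and p_eq: "p = 2 * m + 1"
begin

abbreviation eps :: rat where "eps \<equiv> (-1) ^ m"

abbreviation S :: "nat \<Rightarrow> rat" where "S N \<equiv> \<Sum>k\<le>N. (cbin k)\<^sup>2"

abbreviation norm_const :: "nat \<Rightarrow> rat" where "norm_const N \<equiv> 4 ^ N * (fact N)\<^sup>2"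

lemma odd_p: "odd p"
  using p_eq by simp

lemma m_pos: "m > 0"
  using prime_gt_1_nat[OF prime_p] p_eq by simp

lemma pdiv_inverse: "\<not> p dvd n \<Longrightarrow> pdiv p 0 (1 / of_nat n)"
  using prime_imp_coprime[OF prime_p, of n]
  by (intro pdiv_inverse_of_nat) (auto simp: coprime_commute intro: Nat.gr0I)

lemma not_p_dvd: "0 < n \<Longrightarrow> n < p \<Longrightarrow> \<not> p dvd n"
  using dvd_imp_le by fastforce

lemma not_p_dvd_double: "\<not> p dvd n \<Longrightarrow> \<not> p dvd 2 * n"
  using prime_p odd_p prime_dvd_mult_iff[of p 2 n] by (metis dvd_refl primes_dvd_imp_eq two_is_prime_nat)

lemma not_p_dvd_2: "\<not> p dvd 2"
  using prime_p odd_p by (metis primes_dvd_imp_eq two_is_prime_nat)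

lemma not_p_dvd_4_power: "\<not> p dvd 4 ^ k"
proof -
  have "(4 :: nat) ^ k = 2 ^ (2 * k)" by (simp add: power_mult)
  thus ?thesis using not_p_dvd_2 prime_dvd_power[OF prime_p, of 2 "2 * k"] by metis
qed

lemma pdiv_half: "pdiv p n (2 * x) \<Longrightarrow> pdiv p n x"
proof -
  assume "pdiv p n (2 * x)"
  moreover have "pdiv p 0 (1 / of_nat 2)"
    by (rule pdiv_inverse[OF not_p_dvd_2])
  ultimately show ?thesis using pdiv_mult_right[of p n "2 * x" "1 / of_nat 2"] by simp
qed

lemma pdiv_mult3: "pdiv p 1 x \<Longrightarrow> pdiv p 2 y \<Longrightarrow> pdiv p 3 (x * y)"
  using pdiv_mult[of p 1 x 2 y] by (simp add: numeral_3_eq_3)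

lemma pdiv_mult2: "pdiv p 1 x \<Longrightarrow> pdiv p 1 y \<Longrightarrow> pdiv p 2 (x * y)"
  using pdiv_mult[of p 1 x 1 y] by (simp add: numeral_2_eq_2)

lemma pdiv_p: "pdiv p n (of_nat p ^ n * x)" if "pdiv p 0 x"
  using that unfolding pdiv_0_iff unfolding pdiv_def by blast

lemma pdiv_p1: "pdiv p 1 (of_nat p * x)" if "pdiv p 0 x"
  using pdiv_p[OF that, of 1] by simp

lemma pdiv_eps: "pdiv p 0 eps"
  by (rule pdiv_power) (use pdiv_uminus in simp)

lemma eps_power2 [simp]: "eps * eps = 1"
  by (simp flip: power_add)

lemma pdiv_cbin [simp]: "pdiv p 0 (cbin k)"
proof -
  have "pdiv p 0 (1 / of_nat (4 ^ k))" by (rule pdiv_inverse[OF not_p_dvd_4_power])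
  from pdiv_mult_left[OF this pdiv_of_nat] show ?thesis by (simp add: cbin_def)
qed

lemma pdiv_cbin_power2 [simp]: "pdiv p 0 ((cbin k)\<^sup>2)"
  by (simp add: pdiv_power)

lemma pdiv_S [simp]: "pdiv p 0 (S N)"
  by (simp add: pdiv_sum)

section \<open>The sums up to m and up to p - 1 modulo p^3\<close>

lemma pdiv_inverse_norm_const: "N < p \<Longrightarrow> pdiv p 0 (1 / norm_const N)"
proof -
  assume "N < p"
  hence "\<not> p dvd fact N" using prime_p by (simp add: prime_dvd_fact_iff)
  hence "\<not> p dvd 4 ^ N * (fact N)\<^sup>2"
    using prime_p not_p_dvd_4_power[of N] prime_dvd_power[OF prime_p, of "fact N" 2] by (auto simp: prime_dvd_mult_iff)
  from pdiv_inverse[OF this] show ?thesis by simp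
qed

text \<open>The scaling constant is \<open>chain_prod\<close> at X = 1, that is at Z = 0, where
  Z^(p-1) - 1 is -1. This gives 1 for N = p - 1 and, in the next lemma, \<open>- eps\<close> for N =
  m.\<close>

lemma norm_const_full: "pdiv p 1 (norm_const (p - 1) - 1)"
proof -
  have "int p dvd poly (chain_prod (p - 1) [:1, 1:] - ([:1 - 1, 1:] ^ (p - 1) - 1)\<^sup>2) 0"
    by (rule const_dvd_poly[OF chain_prod_mod_full[OF prime_p odd_p]])
  moreover have "poly (chain_prod (p - 1) [:1, 1:]) 0 = chain_prod (p - 1) (1 :: int)"
    by (simp add: chain_prod_def poly_prod)
  ultimately have "int p ^ 1 dvd 4 ^ (p - 1) * (fact (p - 1))\<^sup>2 - 1"
    using m_pos by (simp add: p_eq chain_prod_one poly_power zero_power)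
  from pdiv_of_int_power[OF this] show ?thesis by simp
qed

lemma norm_const_half: "pdiv p 1 (norm_const m + eps)"
proof -
  have "int p dvd poly (chain_prod m [:1, 1:] - (-1) ^ m * ([:1 - 1, 1:] ^ (p - 1) - 1)) 0"
    by (rule const_dvd_poly[OF chain_prod_mod_half[OF prime_p p_eq]])
  moreover have "poly (chain_prod m [:1, 1:]) 0 = chain_prod m (1 :: int)"
    by (simp add: chain_prod_def poly_prod)
  ultimately have "int p ^ 1 dvd 4 ^ m * (fact m)\<^sup>2 + (-1) ^ m"
    using m_pos by (simp add: p_eq chain_prod_one poly_power zero_power)
  from pdiv_of_int_power[OF this] show ?thesis by simp
qed

text \<open>As p = 2m + 1 with m <= N, the deformed sum at p is exactly \<open>eps\<close>, while at
  0 it is \<open>S N\<close>.\<close>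

lemma S_taylor:
  assumes "m \<le> N"
  shows "pdiv p 3 (norm_const N * (eps - S N) - of_nat p ^ 2 * of_int (quad_coeff N 0))"
proof -
  have "trunc_sum N (of_nat p :: rat) = eps * norm_const N"
    using trunc_sum_odd[OF assms, where ?'a = rat] by (simp add: p_eq add.commute)
  moreover have "trunc_sum N (0 :: rat) = norm_const N * S N" by (simp add: trunc_sum_eq_cbin)
  ultimately show ?thesis
    using pdiv_of_int_power[OF trunc_sum_taylor[of p N]] by (simp add: of_int_trunc_sum algebra_simps)
qed

lemma S_mod_p2:
  assumes "m \<le> N" "N < p" shows "pdiv p 2 (S N - eps)"
proof -
  have "pdiv p 2 (norm_const N * (eps - S N) - of_nat p ^ 2 * of_int (quad_coeff N 0))"
    by (rule pdiv_mono[OF S_taylor[OF assms(1)]]) simp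
  moreover have "pdiv p 2 (of_nat p ^ 2 * of_int (quad_coeff N 0))" by (rule pdiv_p) simp
  ultimately have "pdiv p 2 ((norm_const N * (eps - S N) - of_nat p ^ 2 * of_int (quad_coeff N 0)) + of_nat p ^ 2 * of_int (quad_coeff N 0))"
    by (rule pdiv_add)
  hence "pdiv p 2 (norm_const N * (eps - S N))" by simp
  from pdiv_mult_right[OF this pdiv_inverse_norm_const[OF assms(2)]] have "pdiv p 2 (eps - S N)" by simp
  thus ?thesis by (rule pdiv_sym)
qed

text \<open>Both \<open>eps - S N\<close> are divisible by p^2, so the scaling constants may be
  replaced by their residues 1 and \<open>- eps\<close> modulo p. The quadratic terms then cancel by
  \<open>quad_coeff_combination\<close>.\<close>

lemma S_half_plus_full: "pdiv p 3 (S m + S (p - 1) - 2 * eps)"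
proof -
  let ?c = "of_int (quad_coeff (p - 1) 0) :: rat" and ?d = "of_int (quad_coeff m 0) :: rat" and ?p = "of_nat p ^ 2 :: rat"
  have bounds: "m \<le> p - 1" "p - 1 < p" "m < p" using p_eq by auto
  have 1: "pdiv p 3 (norm_const (p - 1) * (eps - S (p - 1)) - ?p * ?c)" by (rule S_taylor[OF bounds(1)])
  have 2: "pdiv p 3 (norm_const m * (eps - S m) - ?p * ?d)" by (rule S_taylor) simp
  have 3: "pdiv p 3 ((norm_const (p - 1) - 1) * (S (p - 1) - eps))"
    by (rule pdiv_mult3[OF norm_const_full S_mod_p2[OF bounds(1,2)]])
  have 4: "pdiv p 3 ((norm_const m + eps) * (S m - eps))"
    by (rule pdiv_mult3[OF norm_const_half S_mod_p2[OF order.refl bounds(3)]])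
  have "pdiv p 1 (of_int (quad_coeff (p - 1) 0 - (-1) ^ m * quad_coeff m 0))"
    using quad_coeff_combination[OF prime_p p_eq] by (intro pdiv_of_int_power) simp
  hence "pdiv p 1 (?c - eps * ?d)" by simp
  from pdiv_mult3[OF this pdiv_p[OF pdiv_1, of 2]] have 5: "pdiv p 3 (?p * (?c - eps * ?d))" by (simp add: mult.commute)
  have "pdiv p 3 ((norm_const (p - 1) * (eps - S (p - 1)) - ?p * ?c) + (norm_const (p - 1) - 1) * (S (p - 1) - eps) + ?p * (?c - eps * ?d)
      - eps * ((norm_const m * (eps - S m) - ?p * ?d) + (norm_const m + eps) * (S m - eps)))"
    by (intro pdiv_add pdiv_diff pdiv_mult_left pdiv_eps 1 2 3 4 5)
  also have "(norm_const (p - 1) * (eps - S (p - 1)) - ?p * ?c) + (norm_const (p - 1) - 1) * (S (p - 1) - eps) + ?p * (?c - eps * ?d)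
      - eps * ((norm_const m * (eps - S m) - ?p * ?d) + (norm_const m + eps) * (S m - eps))
      = (eps - S (p - 1)) - (eps * eps) * (S m - eps)"
  proof -
    have "(k * (e - s) - P * c) + (k - 1) * (s - e) + P * (c - e * d) - e * ((l * (e - t) - P * d) + (l + e) * (t - e))
        = (e - s) - (e * e) * (t - e)" for k e s P c d l t :: rat by (simp add: algebra_simps)
    thus ?thesis .
  qed
  also have "\<dots> = - (S m + S (p - 1) - 2 * eps)" by simp
  finally have "pdiv p 3 (- (S m + S (p - 1) - 2 * eps))" .
  from pdiv_uminus[OF this] show ?thesis by simp
qed

section \<open>Central binomials at m and between m and p\<close>

lemma cbin_half: "pdiv p 1 (cbin m * eps - 1)"
proof -
  have "((2 * m) choose m) * (fact m * fact m) = fact (2 * m)"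
    using binomial_fact_lemma[of m "2 * m"] by (simp add: mult_ac)
  hence "(of_nat ((2 * m) choose m) :: rat) * (fact m)\<^sup>2 = fact (2 * m)"
    by (metis of_nat_fact of_nat_mult power2_eq_square)
  \<comment> \<open>The product is (p - 1)!, so Wilson's theorem and the residue of
    \<open>norm_const m\<close> determine \<open>cbin m\<close> modulo p.\<close>
  hence w: "cbin m * norm_const m = fact (2 * m)" by (simp add: cbin_def)
  have "int p dvd fact (2 * m) + 1"
    using wilson_theorem[OF prime_p] by (simp add: cong_iff_dvd_diff p_eq)
  hence "pdiv p 1 (of_int (fact (2 * m) + 1))" by (intro pdiv_of_int_power) simp
  hence 1: "pdiv p 1 (cbin m * norm_const m + 1)" by (simp add: w)
  have 2: "pdiv p 1 (cbin m * (norm_const m + eps))" by (rule pdiv_mult_left[OF norm_const_half]) simp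
  have "pdiv p 1 ((cbin m * (norm_const m + eps)) - (cbin m * norm_const m + 1))" by (rule pdiv_diff[OF 2 1])
  thus ?thesis by (simp add: algebra_simps)
qed

lemma cbin_half_power2: "pdiv p 1 ((cbin m)\<^sup>2 - 1)"
proof -
  have "pdiv p 1 ((cbin m * eps)\<^sup>2 - 1\<^sup>2)"
    by (rule pdiv_diff_power2[OF cbin_half]) (simp_all add: pdiv_mult_left pdiv_eps)
  thus ?thesis by (simp add: power2_eq_square mult_ac)
qed

lemma cbin_m_Suc: "cbin (Suc m) = of_nat p * (cbin m * (1 / of_nat (p + 1)))"
  unfolding cbin_Suc by (simp add: p_eq)

lemma pdiv_inverse_p1: "pdiv p 0 (1 / of_nat (p + 1))"
  using prime_p dvd_add_right_iff[of p p 1] by (intro pdiv_inverse) auto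

text \<open>The step from m to m + 1 brings in the numerator 2m + 1 = p; the later denominators 2(k
  + 1) with k + 1 < p cannot cancel it.\<close>

lemma pdiv_cbin_upper:
  assumes "m < k" "k < p" shows "pdiv p 1 (cbin k)"
proof -
  have "Suc m \<le> k" using assms by simp
  thus ?thesis using assms(2)
  proof (induction k rule: dec_induct)
    case base
    show ?case unfolding cbin_m_Suc by (intro pdiv_p1 pdiv_mult_left pdiv_inverse_p1) simp
  next
    case (step k)
    have "\<not> p dvd 2 * Suc k" using step by (intro not_p_dvd_double not_p_dvd) auto
    from pdiv_mult_left[OF pdiv_inverse[OF this] pdiv_of_nat[of p "2 * k + 1"]]
    have "pdiv p 0 (of_nat (2 * k + 1) / of_nat (2 * k + 2))" by simp
    thus ?case unfolding cbin_Suc using step by (intro pdiv_mult_right) auto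
  qed
qed

lemma cbin_m_Suc_power2: "pdiv p 3 ((cbin (Suc m))\<^sup>2 - of_nat p ^ 2)"
proof -
  let ?v = "1 / of_nat (p + 1) :: rat"
  have "pdiv p 1 (of_nat p * ?v)" by (rule pdiv_p1[OF pdiv_inverse_p1])
  moreover have "of_nat p * ?v = 1 - ?v" by (simp add: field_simps)
  ultimately have "pdiv p 1 (1 - ?v)" by simp
  from pdiv_diff_power2[OF pdiv_sym[OF this]] have v: "pdiv p 1 (?v\<^sup>2 - 1)"
    using pdiv_inverse_p1 by simp
  have "pdiv p 1 ((cbin m)\<^sup>2 * ?v\<^sup>2 - 1 * 1)"
    by (rule pdiv_diff_mult[OF cbin_half_power2 v]) (simp_all only: pdiv_power[OF pdiv_inverse_p1] pdiv_1)
  hence "pdiv p 1 ((cbin m)\<^sup>2 * ?v\<^sup>2 - 1)" by simp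
  from pdiv_mult3[OF this pdiv_p[OF pdiv_1, of 2]] have "pdiv p 3 (of_nat p ^ 2 * ((cbin m)\<^sup>2 * ?v\<^sup>2 - 1))"
    by (simp add: mult.commute)
  moreover have "(cbin (Suc m))\<^sup>2 - of_nat p ^ 2 = of_nat p ^ 2 * ((cbin m)\<^sup>2 * ?v\<^sup>2 - 1)"
    unfolding cbin_m_Suc by (simp only: power_mult_distrib right_diff_distrib mult_1_right)
  ultimately show ?thesis by (simp only:)
qed

text \<open>With s = i + 1, one step multiplies the product by (m - s)/s times (p + 2s)/(p + 2s +
  1). This is -1 modulo p: adding 1 leaves the numerator p(m + s). The second power of p comes from
  \<open>cbin\<close> itself.\<close>

lemma binomial_cbin_upper:
  assumes "i < m"
  shows "pdiv p 2 (of_nat ((m - 1) choose i) * cbin (m + 1 + i) - (-1) ^ i * cbin (Suc m))"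
  using assms
proof (induction i)
  case 0
  thus ?case by simp
next
  case (Suc i)
  define s where "s = Suc i"
  let ?C = "of_nat ((m - 1) choose i) :: rat"
  have "Suc i * ((m - 1) choose Suc i) = (m - 1 - i) * ((m - 1) choose i)"
    using binomial_absorption[of i "m - 1"] binomial_absorb_comp[of "m - 1" i] by simp
  hence "of_nat (Suc i) * (of_nat ((m - 1) choose Suc i) :: rat) = (of_nat m - of_nat s) * ?C"
    using Suc.prems by (metis Suc_diff_le diff_Suc_eq_diff_pred less_imp_le_nat of_nat_diff of_nat_mult s_def)
  hence C: "(of_nat ((m - 1) choose Suc i) :: rat) = (of_nat m - of_nat s) / of_nat s * ?C"
    using of_nat_neq_0[of i, where ?'a = rat] unfolding s_def
    by (metis nonzero_mult_div_cancel_left times_divide_eq_left)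
  let ?w = "of_nat (p + 2 * s) / of_nat (p + 2 * s + 1) :: rat"
  have cbin: "cbin (m + 1 + Suc i) = cbin (m + 1 + i) * ?w"
    using cbin_Suc[of "m + 1 + i"] by (simp add: p_eq s_def)
  have nz: "of_nat s \<noteq> (0 :: rat)" "of_nat (p + 2 * s + 1) \<noteq> (0 :: rat)"
    by (simp_all only: s_def of_nat_eq_0_iff)
  have "(of_nat m - of_nat s) / of_nat s * ?w + 1 =
      ((of_nat m - of_nat s) * of_nat (p + 2 * s) + of_nat s * of_nat (p + 2 * s + 1)) / (of_nat s * of_nat (p + 2 * s + 1))"
  proof -
    have "u / v * (x / y) + 1 = (u * x + v * y) / (v * y)" if "v \<noteq> 0" "y \<noteq> 0" for u v x y :: rat
      using that by (simp add: field_simps)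
    from this[OF nz] show ?thesis .
  qed
  also have "(of_nat m - of_nat s) * of_nat (p + 2 * s) + of_nat s * of_nat (p + 2 * s + 1) = (of_nat p * of_nat (m + s) :: rat)"
    by (simp add: p_eq algebra_simps)
  finally have ratio: "(of_nat m - of_nat s) / of_nat s * ?w + 1 =
     of_nat p * (of_nat (m + s) * ((1 / of_nat s) * (1 / of_nat (p + 2 * s + 1))))"
    by simp
  have "pdiv p 0 (1 / of_nat s)" using Suc.prems p_eq by (intro pdiv_inverse not_p_dvd) (auto simp: s_def)
  moreover have "pdiv p 0 (1 / of_nat (p + 2 * s + 1))"
  proof (rule pdiv_inverse)
    have "\<not> p dvd 2 * (m + 1 + s)" using Suc.prems p_eq by (intro not_p_dvd_double not_p_dvd) (auto simp: s_def)
    thus "\<not> p dvd p + 2 * s + 1" by (simp add: p_eq algebra_simps)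
  qed
  ultimately have r1: "pdiv p 1 ((of_nat m - of_nat s) / of_nat s * ?w + 1)"
    unfolding ratio by (intro pdiv_p1 pdiv_mult_left pdiv_of_nat)
  have "pdiv p 2 (cbin (m + 1 + i) * ((of_nat m - of_nat s) / of_nat s * ?w + 1))"
    using Suc.prems p_eq by (intro pdiv_mult2 r1 pdiv_cbin_upper) auto
  hence "pdiv p 2 (?C * (cbin (m + 1 + i) * ((of_nat m - of_nat s) / of_nat s * ?w + 1)))"
    by (rule pdiv_mult_left[OF _ pdiv_of_nat])
  moreover have "pdiv p 2 (?C * cbin (m + 1 + i) - (-1) ^ i * cbin (Suc m))" using Suc by simp
  ultimately have "pdiv p 2 (?C * (cbin (m + 1 + i) * ((of_nat m - of_nat s) / of_nat s * ?w + 1)) - (?C * cbin (m + 1 + i) - (-1) ^ i * cbin (Suc m)))"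
    by (rule pdiv_diff)
  moreover have "?C * (cbin (m + 1 + i) * ((of_nat m - of_nat s) / of_nat s * ?w + 1)) - (?C * cbin (m + 1 + i) - (-1) ^ i * cbin (Suc m))
     = of_nat ((m - 1) choose Suc i) * cbin (m + 1 + Suc i) - (-1) ^ Suc i * cbin (Suc m)"
  proof -
    have "c * (x * (u * w + 1)) - (c * x - e * y) = u * c * (x * w) - (- 1 * e) * y" for c x u w e y :: rat
      by (simp add: algebra_simps)
    thus ?thesis unfolding C cbin power_Suc .
  qed
  ultimately show ?case by (simp only:)
qed

text \<open>In the difference of squares, the difference carries p^2 and the sum carries p. The
  binomial is prime to p because it divides (m - 1)!.\<close>

lemma cbin_upper_power2:
  assumes "i < m"
  shows "pdiv p 3 ((cbin (m + 1 + i))\<^sup>2 - of_nat p ^ 2 / (of_nat ((m - 1) choose i))\<^sup>2)"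
    and "pdiv p 0 (1 / (of_nat ((m - 1) choose i))\<^sup>2)"
proof -
  let ?C = "of_nat ((m - 1) choose i) :: rat" and ?a = "cbin (m + 1 + i)" and ?b = "(-1) ^ i * cbin (Suc m)"
  have "(m - 1) choose i dvd fact (m - 1)"
    using binomial_fact_lemma[of i "m - 1"] assms dvd_triv_right[of "(m - 1) choose i" "fact i * fact (m - 1 - i)"] by simp
  moreover have "\<not> p dvd fact (m - 1)" using prime_p p_eq by (simp add: prime_dvd_fact_iff)
  ultimately have nd: "\<not> p dvd (m - 1) choose i" using dvd_trans by blast
  have nz: "?C \<noteq> 0" using assms by simp
  have inv: "pdiv p 0 (1 / ?C)" by (rule pdiv_inverse[OF nd])
  thus inv2: "pdiv p 0 (1 / ?C\<^sup>2)" using pdiv_power[OF inv, of 2] by (simp add: power_divide)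
  have d: "pdiv p 2 (?C * ?a - ?b)" by (rule binomial_cbin_upper[OF assms])
  have "pdiv p 1 ?a" "pdiv p 1 (cbin (Suc m))" using assms p_eq m_pos by (intro pdiv_cbin_upper; simp)+
  hence "pdiv p 1 (?C * ?a + ?b)"
    by (intro pdiv_add pdiv_mult_left) (simp_all add: pdiv_power pdiv_uminus)
  from pdiv_mult3[OF this d] have "pdiv p 3 ((?C * ?a)\<^sup>2 - ?b\<^sup>2)"
    by (simp add: power2_eq_square algebra_simps)
  moreover have "?b\<^sup>2 = (cbin (Suc m))\<^sup>2" by (simp add: power_mult_distrib flip: power_mult)
  ultimately have "pdiv p 3 ((?C * ?a)\<^sup>2 - of_nat p ^ 2)" using pdiv_trans[OF _ cbin_m_Suc_power2] by simp
  from pdiv_mult_left[OF this inv2] show "pdiv p 3 (?a\<^sup>2 - of_nat p ^ 2 / ?C\<^sup>2)"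
    using nz by (simp add: field_simps power_mult_distrib)
qed

section \<open>The cut at 3p/4\<close>

lemma S_upper: "S (m + L) = S m + (\<Sum>i<L. (cbin (m + 1 + i))\<^sup>2)"
  by (induction L) simp_all

text \<open>Writing S(p - 1) as S(m) plus the upper terms turns \<open>S_half_plus_full\<close> into
  a formula for twice S(m), from which only the upper terms remain.\<close>

lemma twice_S_upper:
  assumes "L \<le> m"
  shows "pdiv p 3 (2 * (S (m + L) - eps) - (2 * (\<Sum>i<L. of_nat p ^ 2 / (of_nat ((m - 1) choose i))\<^sup>2)
     - (\<Sum>i<m. of_nat p ^ 2 / (of_nat ((m - 1) choose i))\<^sup>2)))"
proof -
  let ?q = "\<lambda>i. of_nat p ^ 2 / (of_nat ((m - 1) choose i))\<^sup>2 :: rat" and ?a = "\<lambda>i. (cbin (m + 1 + i))\<^sup>2"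
  have 1: "pdiv p 3 (sum ?a {..<L} - sum ?q {..<L})" "pdiv p 3 (sum ?a {..<m} - sum ?q {..<m})"
    using assms by (intro pdiv_diff_sum cbin_upper_power2; simp)+
  have "p - 1 = m + m" using p_eq by simp
  hence 2: "pdiv p 3 (S m + (S m + sum ?a {..<m}) - 2 * eps)" using S_half_plus_full unfolding S_upper[of m, symmetric] by simp
  have "pdiv p 3 (2 * (sum ?a {..<L} - sum ?q {..<L}) - (sum ?a {..<m} - sum ?q {..<m}) + (S m + (S m + sum ?a {..<m}) - 2 * eps))"
    by (intro pdiv_add pdiv_diff pdiv_mult_left 1 2) simp
  thus ?thesis unfolding S_upper by (simp add: algebra_simps)
qed

text \<open>The even number m of symmetric terms splits into two equal halves, so nothing is left
  over.\<close>

lemma sum_three_quarters_1: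
  assumes "m = L + L" shows "pdiv p 3 (S (m + L) - eps)"
proof -
  let ?q = "\<lambda>i. of_nat p ^ 2 / (of_nat ((m - 1) choose i))\<^sup>2 :: rat"
  have "sum ?q {..<L + L} = sum ?q {..<L} + sum ?q {..<L}"
  proof (rule sum_symmetric_split)
    fix i assume "i < L + L"
    hence i: "i \<le> m - 1" and eq: "L + L - 1 - i = m - 1 - i" using assms by linarith+
    show "?q (L + L - 1 - i) = ?q i" unfolding eq by (simp only: binomial_symmetric[OF i, symmetric])
  qed
  hence "2 * sum ?q {..<L} - sum ?q {..<m} = 0" unfolding assms [symmetric] by linarith
  moreover have "pdiv p 3 (2 * (S (m + L) - eps) - (2 * sum ?q {..<L} - sum ?q {..<m}))"
    by (rule twice_S_upper) (use assms in linarith)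
  ultimately have "pdiv p 3 (2 * (S (m + L) - eps))" by (simp only: diff_zero)
  thus ?thesis by (rule pdiv_half)
qed

text \<open>Now m is odd, and twice the first M + 1 terms exceeds the whole by the middle
  term.\<close>

lemma sum_three_quarters_3:
  assumes "m = M + Suc M"
  shows "pdiv p 3 (2 * (S (m + M + 1) - eps) - of_nat p ^ 2 / (of_nat ((2 * M) choose M))\<^sup>2)"
proof -
  let ?q = "\<lambda>i. of_nat p ^ 2 / (of_nat ((m - 1) choose i))\<^sup>2 :: rat"
  have "sum ?q {..<M + Suc M} = sum ?q {..<M} + sum ?q {..<Suc M}"
  proof (rule sum_symmetric_split)
    fix i assume "i < M + Suc M"
    hence i: "i \<le> m - 1" and eq: "M + Suc M - 1 - i = m - 1 - i" using assms by linarith+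
    show "?q (M + Suc M - 1 - i) = ?q i" unfolding eq by (simp only: binomial_symmetric[OF i, symmetric])
  qed
  moreover have "2 * (x + y) - (x + (x + y)) = y" for x y :: rat by simp
  ultimately have "2 * sum ?q {..<Suc M} - sum ?q {..<m} = ?q M"
    unfolding assms [symmetric] sum.lessThan_Suc by (simp only:)
  moreover have "pdiv p 3 (2 * (S (m + Suc M) - eps) - (2 * sum ?q {..<Suc M} - sum ?q {..<m}))"
    by (rule twice_S_upper) (use assms in linarith)
  moreover have "m - 1 = 2 * M" "m + Suc M = m + M + 1" using assms by linarith+
  ultimately show ?thesis by (simp only:)
qed

section \<open>Prime powers\<close>

text \<open>\<open>a\<^sub>p\<^sub>K\<^sub>+\<^sub>r / a\<^sub>p\<^sub>K\<close> with the factor \<open>p (2K + 1)\<close>, which enters at \<open>j = m\<close>, left out.\<close>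

definition digit_factor :: "nat \<Rightarrow> nat \<Rightarrow> rat" where
  "digit_factor K r = (\<Prod>j<r. (if j = m then 1 else of_nat (2 * p * K + 2 * j + 1)) / of_nat (2 * p * K + 2 * j + 2))"

lemma cbin_digit_factor:
  "cbin (p * K + r) = cbin (p * K) * digit_factor K r * (if r > m then of_nat p * of_nat (2 * K + 1) else 1)"
proof (induction r)
  case (Suc r)
  have "cbin (p * K + Suc r) = cbin (p * K + r) * (of_nat (2 * p * K + 2 * r + 1) / of_nat (2 * p * K + 2 * r + 2))"
    using cbin_Suc[of "p * K + r"] by (simp add: algebra_simps)
  moreover have "2 * p * K + 2 * m + 1 = p * (2 * K + 1)" by (simp add: p_eq algebra_simps)
  hence "(of_nat (2 * p * K + 2 * m + 1) :: rat) = of_nat p * of_nat (2 * K + 1)" by (metis of_nat_mult)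
  ultimately show ?case unfolding Suc digit_factor_def by (cases r m rule: linorder_cases) (simp_all only: prod.lessThan_Suc, simp_all)
qed (simp add: digit_factor_def)

text \<open>Changing K moves numerators and denominators by multiples of p, and the denominators
  2(pK + j + 1) with j + 1 < p are units.\<close>

lemma pdiv_digit_factor:
  assumes "r < p"
  shows "pdiv p 0 (digit_factor K r) \<and> pdiv p 1 (digit_factor K r - digit_factor 0 r)"
  using assms
proof (induction r)
  case 0
  thus ?case by (simp add: digit_factor_def)
next
  case (Suc r)
  let ?t = "\<lambda>K. (if r = m then 1 else of_nat (2 * p * K + 2 * r + 1)) :: rat"
  let ?u = "\<lambda>K. 1 / of_nat (2 * p * K + 2 * r + 2) :: rat"
  have nd: "\<not> p dvd 2 * p * K + 2 * r + 2" for K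
  proof -
    have "\<not> p dvd 2 * Suc r" using Suc.prems by (intro not_p_dvd_double not_p_dvd) auto
    moreover have "2 * p * K + 2 * r + 2 = p * (2 * K) + 2 * Suc r" by simp
    ultimately show ?thesis by (metis dvd_add_right_iff dvd_triv_left)
  qed
  have u: "pdiv p 0 (?u K)" for K by (rule pdiv_inverse[OF nd])
  have t: "pdiv p 0 (?t K)" for K using pdiv_of_nat[of p "2 * p * K + 2 * r + 1"] by simp
  have "?t K - ?t 0 = of_nat p * (if r = m then 0 else of_nat (2 * K))" by simp
  hence dt: "pdiv p 1 (?t K - ?t 0)" using pdiv_p1[OF pdiv_of_nat[of p "2 * K"]] by simp
  have "?u K - ?u 0 = of_nat p * (of_nat (2 * K) * ((-1) * (?u K * ?u 0)))"
  proof -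
    have "1 / a - 1 / b = (b - a) * (1 / a * (1 / b))" if "a \<noteq> 0" "b \<noteq> 0" for a b :: rat
      using that by (simp add: field_simps)
    moreover have "of_nat (2 * p * K + 2 * r + 2) \<noteq> (0 :: rat)" "of_nat (2 * p * 0 + 2 * r + 2) \<noteq> (0 :: rat)"
      by (simp_all only: of_nat_eq_0_iff)
    ultimately have "?u K - ?u 0 = (of_nat (2 * p * 0 + 2 * r + 2) - of_nat (2 * p * K + 2 * r + 2)) * (?u K * ?u 0)" by blast
    thus ?thesis by simp
  qed
  moreover have "pdiv p 1 (of_nat p * (of_nat (2 * K) * ((-1) * (?u K * ?u 0))))"
    by (intro pdiv_p1 pdiv_mult_left u pdiv_of_nat pdiv_uminus pdiv_1)
  ultimately have du: "pdiv p 1 (?u K - ?u 0)" by (simp only:)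
  have eq: "digit_factor K (Suc r) = digit_factor K r * (?t K * ?u K)" for K by (simp add: digit_factor_def)
  have tu: "pdiv p 1 (?t K * ?u K - ?t 0 * ?u 0)" by (rule pdiv_diff_mult[OF dt du t u])
  have IH: "pdiv p 0 (digit_factor K r)" "pdiv p 1 (digit_factor K r - digit_factor 0 r)"
    using Suc by auto
  have IH0: "pdiv p 0 (digit_factor 0 r)"
    using IH pdiv_mono[OF IH(2), of 0] pdiv_diff[of p 0 "digit_factor K r" "digit_factor K r - digit_factor 0 r"] by simp
  show ?case unfolding eq
    by (intro conjI pdiv_diff_mult pdiv_mult_left IH IH0 tu t u)
qed

lemma pdiv_cancel_p: "pdiv p (Suc n) (of_nat p * x) \<Longrightarrow> pdiv p n x"
  using prime_gt_0_nat[OF prime_p] unfolding pdiv_def by (auto simp: mult.assoc)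

lemma cbin_eq_digit_factor: "cbin r = digit_factor 0 r * (if r > m then of_nat p else 1)"
  using cbin_digit_factor[of 0 r] by simp

text \<open>The case i = m - 1 of \<open>binomial_cbin_upper\<close> gives that
  \<open>cbin (p - 1)\<close> is -p modulo p^2; one factor p is then cancelled.\<close>

lemma digit_factor_last: "pdiv p 1 (digit_factor 0 (p - 1) + 1)"
proof -
  have 1: "pdiv p 2 (cbin (p - 1) - (-1) ^ (m - 1) * cbin (Suc m))"
    using binomial_cbin_upper[of "m - 1"] m_pos by (simp add: p_eq mult_2)
  let ?v = "1 / of_nat (p + 1) :: rat"
  have eps: "(-1) ^ (m - 1) = - eps" using m_pos by (cases m) simp_all
  have "of_nat p * ?v = 1 - ?v" by (simp add: field_simps)
  hence "pdiv p 1 (1 - ?v)" using pdiv_p1[OF pdiv_inverse_p1] by simp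
  hence v: "pdiv p 1 (?v - 1)" by (rule pdiv_sym)
  have "pdiv p 1 (cbin m * eps * ?v - 1 * 1)"
    by (rule pdiv_diff_mult[OF cbin_half v pdiv_1 pdiv_inverse_p1])
  hence "pdiv p 1 (- (cbin m * eps * ?v - 1 * 1))" by (rule pdiv_uminus)
  hence "pdiv p 2 (of_nat p * (- (cbin m * eps * ?v - 1 * 1)))"
    using pdiv_mult2[OF pdiv_p1[OF pdiv_1]] by simp
  moreover have "of_nat p * (- (cbin m * eps * ?v - 1 * 1)) = (-1) ^ (m - 1) * cbin (Suc m) - - of_nat p"
    unfolding cbin_m_Suc eps by (simp add: algebra_simps)
  ultimately have "pdiv p 2 ((-1) ^ (m - 1) * cbin (Suc m) - - of_nat p)" by (simp only:)
  from pdiv_trans[OF 1 this] have 2: "pdiv p 2 (cbin (p - 1) - - of_nat p)" .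
  have "p - 1 > m" using m_pos p_eq by linarith
  hence "cbin (p - 1) - - of_nat p = of_nat p * (digit_factor 0 (p - 1) + 1)"
    by (subst cbin_eq_digit_factor) (simp add: algebra_simps)
  with 2 have "pdiv p (Suc 1) (of_nat p * (digit_factor 0 (p - 1) + 1))" by (simp add: numeral_2_eq_2)
  thus ?thesis by (rule pdiv_cancel_p)
qed

text \<open>An exact multiple of \<open>cbin k\<close> is stated instead of a congruence, so that
  powers of p in \<open>cbin k\<close> are not lost. Passing to k + 1 multiplies by the ratio
  belonging to \<open>cbin (Suc k)\<close> and by two factors that are both -1 modulo p.\<close>

lemma cbin_mult_p: "\<exists>\<rho>. cbin (p * k) = cbin k * \<rho> \<and> pdiv p 0 \<rho> \<and> pdiv p 1 (\<rho> - 1)"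
proof (induction k)
  case 0
  thus ?case by (intro exI[of _ 1]) simp
next
  case (Suc k)
  then obtain \<rho> where \<rho>: "cbin (p * k) = cbin k * \<rho>" "pdiv p 0 \<rho>" "pdiv p 1 (\<rho> - 1)" by blast
  define u :: rat where "u = 2 * of_nat p * of_nat (Suc k) - 1"
  have p0: "of_nat p \<noteq> (0 :: rat)" using prime_gt_0_nat[OF prime_p] by simp
  \<comment> \<open>One step past the last digit p - 1 the denominator is p(2k + 2); its p cancels
    the one gained at j = m.\<close>
  have pk: "p * Suc k = Suc (p * k + (p - 1))" using prime_gt_0_nat[OF prime_p] by simp
  have ofn: "of_nat (2 * (p * k + (p - 1)) + 1) = u" "of_nat (2 * (p * k + (p - 1)) + 2) = of_nat p * (of_nat (2 * k + 2) :: rat)"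
    using prime_gt_0_nat[OF prime_p] by (simp_all add: u_def of_nat_diff algebra_simps)
  have "cbin (p * Suc k) = cbin (p * k) * digit_factor k (p - 1) * (of_nat p * of_nat (2 * k + 1)) * (u / (of_nat p * of_nat (2 * k + 2)))"
    unfolding pk cbin_Suc ofn cbin_digit_factor[of k "p - 1"] using m_pos by (simp add: p_eq)
  also have "\<dots> = cbin (Suc k) * (\<rho> * (digit_factor k (p - 1) * u))"
    unfolding \<rho>(1) cbin_Suc using p0 by simp
  finally have eq: "cbin (p * Suc k) = cbin (Suc k) * (\<rho> * (digit_factor k (p - 1) * u))" .
  have d: "pdiv p 0 (digit_factor k (p - 1))" "pdiv p 1 (digit_factor k (p - 1) - digit_factor 0 (p - 1))"
    using pdiv_digit_factor[of "p - 1" k] prime_gt_0_nat[OF prime_p] by auto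
  have d1: "pdiv p 1 (digit_factor k (p - 1) - (-1))"
    using pdiv_trans[OF d(2), of "-1"] digit_factor_last by simp
  have m1: "pdiv p 0 (-1)" using pdiv_uminus[OF pdiv_1] .
  have u0: "pdiv p 0 u" unfolding u_def by (intro pdiv_diff pdiv_mult_left pdiv_1 pdiv_of_nat pdiv_numeral)
  have u1: "pdiv p 1 (u - (-1))" using pdiv_p1[of "of_nat (2 * Suc k)"] pdiv_of_nat[of p "2 * Suc k"]
    by (simp add: u_def mult_ac)
  have "pdiv p 1 (digit_factor k (p - 1) * u - (-1) * (-1))" by (rule pdiv_diff_mult[OF d1 u1 m1 u0])
  hence "pdiv p 1 (\<rho> * (digit_factor k (p - 1) * u) - 1 * 1)"
    using pdiv_mult_left[OF u0 d(1)] by (intro pdiv_diff_mult[OF \<rho>(3)]) simp_all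
  thus ?case using eq pdiv_mult_left[OF pdiv_mult_left[OF u0 d(1)] \<rho>(2)]
    by (intro exI[of _ "\<rho> * (digit_factor k (p - 1) * u)"]) simp
qed

text \<open>A Lucas-type statement. For r > m both the multiplier and \<open>cbin r\<close> vanish
  modulo p.\<close>

lemma cbin_digit:
  assumes "r < p"
  shows "\<exists>\<sigma>. cbin (p * k + r) = cbin k * \<sigma> \<and> pdiv p 0 \<sigma> \<and> pdiv p 1 (\<sigma> - cbin r)"
proof -
  obtain \<rho> where \<rho>: "cbin (p * k) = cbin k * \<rho>" "pdiv p 0 \<rho>" "pdiv p 1 (\<rho> - 1)" using cbin_mult_p by blast
  have d: "pdiv p 0 (digit_factor k r)" "pdiv p 0 (digit_factor 0 r)" "pdiv p 1 (digit_factor k r - digit_factor 0 r)"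
    using pdiv_digit_factor[OF assms] by auto
  show ?thesis
  proof (cases "r > m")
    case True
    have x: "pdiv p 1 (of_nat p * (\<rho> * digit_factor k r * of_nat (2 * k + 1)))"
      by (intro pdiv_p1 pdiv_mult_left \<rho> d pdiv_of_nat)
    have "cbin (p * k + r) = cbin k * (of_nat p * (\<rho> * digit_factor k r * of_nat (2 * k + 1)))"
      unfolding cbin_digit_factor \<rho>(1) using True by simp
    moreover have "pdiv p 1 (cbin r)" by (rule pdiv_cbin_upper[OF True assms])
    ultimately show ?thesis using x pdiv_mono[OF x, of 0] pdiv_diff[OF x] by blast
  next
    case False
    have "cbin (p * k + r) = cbin k * (\<rho> * digit_factor k r)" unfolding cbin_digit_factor \<rho>(1) using False by simp
    moreover have "pdiv p 1 (\<rho> * digit_factor k r - 1 * digit_factor 0 r)" by (rule pdiv_diff_mult[OF \<rho>(3) d(3) pdiv_1 d(1)])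
    hence "pdiv p 1 (\<rho> * digit_factor k r - cbin r)" using False by (simp add: cbin_eq_digit_factor[of r])
    ultimately show ?thesis using pdiv_mult_left[OF d(1) \<rho>(2)] by blast
  qed
qed

text \<open>Keeps the factor 2k + 1 visible, since it may supply further powers of p.\<close>

lemma cbin_digit_upper:
  assumes "m < r" "r < p"
  shows "\<exists>\<tau>. cbin (p * k + r) = cbin k * (of_nat p * (of_nat (2 * k + 1) * \<tau>)) \<and> pdiv p 0 \<tau>"
proof -
  obtain \<rho> where \<rho>: "cbin (p * k) = cbin k * \<rho>" "pdiv p 0 \<rho>" using cbin_mult_p by blast
  have "cbin (p * k + r) = cbin k * (of_nat p * (of_nat (2 * k + 1) * (\<rho> * digit_factor k r)))"
    unfolding cbin_digit_factor \<rho>(1) using assms by simp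
  thus ?thesis using pdiv_mult_left[OF _ \<rho>(2)] pdiv_digit_factor[OF assms(2)] by blast
qed

text \<open>Induction removes the lowest digit of r, whose multipliers with and without k in front
  are both congruent to \<open>cbin\<close> of that digit.\<close>

lemma cbin_top_digit:
  assumes "r < p ^ b"
  shows "\<exists>\<sigma>. cbin (p ^ b * k + r) = cbin k * \<sigma> \<and> pdiv p 0 \<sigma> \<and> pdiv p 1 (\<sigma> - cbin r)"
  using assms
proof (induction b arbitrary: r)
  case 0
  thus ?case by (intro exI[of _ 1]) simp
next
  case (Suc b)
  define r1 r0 where "r1 = r div p" and "r0 = r mod p"
  have r: "r = p * r1 + r0" "r0 < p" using prime_gt_0_nat[OF prime_p] by (simp_all add: r1_def r0_def)
  have "r1 < p ^ b" using Suc.prems by (simp add: r1_def less_mult_imp_div_less mult.commute)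
  from Suc.IH[OF this] obtain \<sigma> where \<sigma>: "cbin (p ^ b * k + r1) = cbin k * \<sigma>" "pdiv p 0 \<sigma>" "pdiv p 1 (\<sigma> - cbin r1)" by blast
  obtain \<tau> where \<tau>: "cbin (p * (p ^ b * k + r1) + r0) = cbin (p ^ b * k + r1) * \<tau>" "pdiv p 0 \<tau>" "pdiv p 1 (\<tau> - cbin r0)"
    using cbin_digit[OF r(2)] by blast
  obtain \<upsilon> where \<upsilon>: "cbin (p * r1 + r0) = cbin r1 * \<upsilon>" "pdiv p 0 \<upsilon>" "pdiv p 1 (\<upsilon> - cbin r0)"
    using cbin_digit[OF r(2)] by blast
  have "pdiv p 1 (\<tau> - \<upsilon>)" using pdiv_trans[OF \<tau>(3) pdiv_sym[OF \<upsilon>(3)]] .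
  hence "pdiv p 1 (\<sigma> * \<tau> - cbin r1 * \<upsilon>)" by (intro pdiv_diff_mult \<sigma> \<tau>) simp_all
  moreover have "p ^ Suc b * k + r = p * (p ^ b * k + r1) + r0" by (simp add: r algebra_simps)
  hence "cbin (p ^ Suc b * k + r) = cbin k * (\<sigma> * \<tau>)" by (simp only: \<tau>(1) \<sigma>(1) mult.assoc)
  ultimately show ?case using \<upsilon>(1) r(1) pdiv_mult_left[OF \<tau>(2) \<sigma>(2)]
    by (intro exI[of _ "\<sigma> * \<tau>"]) simp
qed

lemma cbin_top_digit_power2:
  assumes "r < p ^ b"
  shows "pdiv p 1 ((cbin (p ^ b * k + r))\<^sup>2 - (cbin k)\<^sup>2 * (cbin r)\<^sup>2)"
    and "pdiv p 1 (cbin k) \<Longrightarrow> pdiv p 3 ((cbin (p ^ b * k + r))\<^sup>2 - (cbin k)\<^sup>2 * (cbin r)\<^sup>2)"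
proof -
  obtain \<sigma> where \<sigma>: "cbin (p ^ b * k + r) = cbin k * \<sigma>" "pdiv p 0 \<sigma>" "pdiv p 1 (\<sigma> - cbin r)"
    using cbin_top_digit[OF assms] by blast
  have eq: "(cbin (p ^ b * k + r))\<^sup>2 - (cbin k)\<^sup>2 * (cbin r)\<^sup>2 = (\<sigma>\<^sup>2 - (cbin r)\<^sup>2) * (cbin k)\<^sup>2"
    unfolding \<sigma>(1) by (simp add: power_mult_distrib algebra_simps)
  have d: "pdiv p 1 (\<sigma>\<^sup>2 - (cbin r)\<^sup>2)" by (rule pdiv_diff_power2[OF \<sigma>(3,2)]) simp
  show "pdiv p 1 ((cbin (p ^ b * k + r))\<^sup>2 - (cbin k)\<^sup>2 * (cbin r)\<^sup>2)"
    unfolding eq by (rule pdiv_mult_right[OF d]) simp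
  assume "pdiv p 1 (cbin k)"
  thus "pdiv p 3 ((cbin (p ^ b * k + r))\<^sup>2 - (cbin k)\<^sup>2 * (cbin r)\<^sup>2)"
    unfolding eq using pdiv_mult3[OF d] pdiv_mult2[of "cbin k" "cbin k"] by (simp add: power2_eq_square)
qed

section \<open>The number (p^b - 1)/2, all of whose base-p digits are m\<close>

fun half_pow :: "nat \<Rightarrow> nat" where
  "half_pow 0 = 0"
| "half_pow (Suc b) = p * half_pow b + m"

lemma half_pow_eq: "2 * half_pow b + 1 = p ^ b"
proof (induction b)
  case (Suc b)
  have "2 * half_pow (Suc b) + 1 = p * (2 * half_pow b) + p"
  proof -
    have "2 * (t + m) + 1 = 2 * t + p" for t using p_eq by simp
    thus ?thesis unfolding half_pow.simps mult.left_commute[of p 2] .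
  qed
  also have "\<dots> = p * (2 * half_pow b + 1)" by simp
  finally show ?case by (simp only: Suc power_Suc)
qed simp

lemma half_pow_Suc_top: "half_pow (Suc b) = p ^ b * m + half_pow b"
proof -
  have "p ^ Suc b = (2 * m + 1) * p ^ b" using p_eq by (metis power_Suc)
  also have "\<dots> = 2 * (p ^ b * m) + p ^ b" by (simp add: algebra_simps)
  finally show ?thesis using half_pow_eq[of b] half_pow_eq[of "Suc b"] by linarith
qed

lemma half_pow_less: "half_pow b < p ^ b"
  using half_pow_eq[of b] by linarith

lemma minus_one_power_half_pow: "(-1 :: rat) ^ half_pow b = eps ^ b"
proof (induction b)
  case (Suc b)
  have "(-1 :: rat) ^ (p * half_pow b) = (-1) ^ half_pow b" using odd_p by (simp add: power_mult)
  thus ?case using Suc by (simp add: power_add)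
qed simp

lemma half_pow_digit_cases:
  assumes "half_pow (Suc b) < p * r1 + r0" "r0 < p"
  shows "half_pow b < r1 \<or> r1 = half_pow b \<and> m < r0"
proof (rule ccontr)
  assume "\<not> ?thesis"
  then consider "r1 < half_pow b" | "r1 = half_pow b" "r0 \<le> m" by linarith
  thus False
  proof cases
    case 1
    hence "p * Suc r1 \<le> p * half_pow b" by (intro mult_le_mono2) simp
    thus ?thesis using assms by simp
  next
    case 2
    thus ?thesis using assms by simp
  qed
qed

text \<open>Such an r has a digit exceeding m, and that digit contributes a factor p.\<close>

lemma pdiv_cbin_above_half_pow:
  assumes "half_pow b < r" "r < p ^ b" shows "pdiv p 1 (cbin r)"
  using assms
proof (induction b arbitrary: r)
  case (Suc b)
  define r1 r0 where "r1 = r div p" and "r0 = r mod p"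
  have r: "r = p * r1 + r0" "r0 < p" using prime_gt_0_nat[OF prime_p] by (simp_all add: r1_def r0_def)
  have "r1 < p ^ b" using Suc.prems by (simp add: r1_def less_mult_imp_div_less mult.commute)
  obtain \<sigma> where \<sigma>: "cbin r = cbin r1 * \<sigma>" "pdiv p 0 \<sigma>" "pdiv p 1 (\<sigma> - cbin r0)"
    using cbin_digit[OF r(2), of r1] r(1) by blast
  from half_pow_digit_cases[of b r1 r0] Suc.prems(1) r consider "half_pow b < r1" | "m < r0" by auto
  thus ?case
  proof cases
    case 1
    thus ?thesis unfolding \<sigma>(1) using Suc.IH \<open>r1 < p ^ b\<close> \<sigma>(2) by (intro pdiv_mult_right) auto
  next
    case 2
    have "pdiv p 1 (cbin r0)" by (rule pdiv_cbin_upper[OF 2 r(2)])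
    from pdiv_add[OF \<sigma>(3) this] have "pdiv p 1 \<sigma>" by simp
    thus ?thesis unfolding \<sigma>(1) by (intro pdiv_mult_left) simp_all
  qed
qed simp

text \<open>Here the carry out of the lower digits meets the top digit \<open>m = (p - 1) / 2\<close> and produces a second carry.\<close>

lemma pdiv_cbin_middle:
  assumes "half_pow b < r" "r < p ^ b" shows "pdiv p 2 (cbin (p ^ b * m + r))"
  using assms
proof (induction b arbitrary: r)
  case (Suc b)
  define r1 r0 where "r1 = r div p" and "r0 = r mod p"
  have r: "r = p * r1 + r0" "r0 < p" using prime_gt_0_nat[OF prime_p] by (simp_all add: r1_def r0_def)
  have r1: "r1 < p ^ b" using Suc.prems by (simp add: r1_def less_mult_imp_div_less mult.commute)
  have k: "p ^ Suc b * m + r = p * (p ^ b * m + r1) + r0" by (simp add: r algebra_simps)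
  from half_pow_digit_cases[of b r1 r0] Suc.prems(1) r consider "half_pow b < r1" | "r1 = half_pow b" "m < r0" by auto
  thus ?case
  proof cases
    case 1
    obtain \<sigma> where "cbin (p ^ Suc b * m + r) = cbin (p ^ b * m + r1) * \<sigma>" "pdiv p 0 \<sigma>"
      using cbin_digit[OF r(2)] unfolding k by blast
    thus ?thesis using Suc.IH[OF 1 r1] by (simp only: pdiv_mult_right)
  next
    case 2
    \<comment> \<open>All digits in front of \<open>r0\<close> equal m, so 2k + 1 is the full power
      p^(b+1); this yields the second factor p.\<close>
    have "2 * (p ^ b * m + r1) + 1 = p * p ^ b" using half_pow_eq[of b] 2 by (simp add: p_eq algebra_simps)
    then obtain \<tau> where \<tau>: "cbin (p ^ Suc b * m + r) = cbin (p ^ b * m + r1) * (of_nat p * (of_nat (p * p ^ b) * \<tau>))" "pdiv p 0 \<tau>"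
      using cbin_digit_upper[OF 2(2) r(2), of "p ^ b * m + r1"] unfolding k by metis
    have "pdiv p 1 (of_nat (p * p ^ b) * \<tau>)"
      using pdiv_p1[OF pdiv_mult_left[OF \<tau>(2) pdiv_of_nat[of p "p ^ b"]]] by (simp add: mult.assoc)
    from pdiv_mult2[OF pdiv_p1[OF pdiv_1] this] have "pdiv p 2 (of_nat p * (of_nat (p * p ^ b) * \<tau>))" by simp
    from pdiv_mult_left[OF this pdiv_cbin] show ?thesis unfolding \<tau>(1) .
  qed
qed simp

section \<open>Block sums modulo p\<close>

lemma S_less: "(\<Sum>k<Suc n. (cbin k)\<^sup>2) = S n"
  by (simp add: lessThan_Suc_atMost)

lemma pdiv_eps_power: "pdiv p 0 (eps ^ b)"
  by (rule pdiv_power[OF pdiv_eps])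

lemma S_above_half_pow:
  assumes "half_pow b \<le> l" "l < p ^ b"
  shows "pdiv p 1 (S l - S (half_pow b))"
proof -
  have "S l - S (half_pow b) = (\<Sum>k\<in>{..l} - {..half_pow b}. (cbin k)\<^sup>2)"
    using assms by (subst sum_diff) auto
  also have "pdiv p 1 \<dots>"
  proof (rule pdiv_sum)
    fix k assume "k \<in> {..l} - {..half_pow b}"
    hence "pdiv p 1 (cbin k)" using assms by (intro pdiv_cbin_above_half_pow[of b]) auto
    thus "pdiv p 1 ((cbin k)\<^sup>2)" by (simp add: power2_eq_square pdiv_mult_right)
  qed
  finally show ?thesis .
qed

text \<open>Modulo p the summand is a product over the leading part and the remainder, so each
  complete block contributes its leading term times one common sum.\<close>

lemma S_blocks_mod_p:
  assumes "l < p ^ b"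
  shows "pdiv p 1 (S (p ^ b * t + l) - ((\<Sum>k<t. (cbin k)\<^sup>2) * S (p ^ b - 1) + (cbin t)\<^sup>2 * S l))"
proof -
  have pb: "{..<p ^ b} = {..p ^ b - 1}" using half_pow_eq[of b] by auto
  have "(\<Sum>k<t. (cbin k)\<^sup>2) * S (p ^ b - 1) = (\<Sum>k<t. \<Sum>r<p ^ b. (cbin k)\<^sup>2 * (cbin r)\<^sup>2)"
    unfolding pb by (simp add: sum_product)
  moreover have "(cbin t)\<^sup>2 * S l = (\<Sum>r\<le>l. (cbin t)\<^sup>2 * (cbin r)\<^sup>2)" by (simp add: sum_distrib_left)
  moreover have "pdiv p 1 ((\<Sum>k<t. \<Sum>r<p ^ b. (cbin (p ^ b * k + r))\<^sup>2) - (\<Sum>k<t. \<Sum>r<p ^ b. (cbin k)\<^sup>2 * (cbin r)\<^sup>2))"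
    by (intro pdiv_diff_sum cbin_top_digit_power2) simp
  moreover have "pdiv p 1 ((\<Sum>r\<le>l. (cbin (p ^ b * t + r))\<^sup>2) - (\<Sum>r\<le>l. (cbin t)\<^sup>2 * (cbin r)\<^sup>2))"
    using assms by (intro pdiv_diff_sum cbin_top_digit_power2) simp
  ultimately show ?thesis
    unfolding sum_blocks[OF assms] using pdiv_add by (fastforce simp: algebra_simps)
qed

lemma S_full_power: "pdiv p 1 (S (p ^ b - 1) - eps ^ b)"
proof (induction b)
  case 0
  thus ?case by simp
next
  case (Suc b)
  have p0: "p > 0" "p ^ b > 0" using prime_gt_0_nat[OF prime_p] by simp_all
  have bounds: "m \<le> p - 1" "p - 1 < p" using p_eq p0 by linarith+
  obtain p' where p': "p = Suc p'" using p0 by (cases p) auto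
  have "p ^ b * (p - 1) + (p ^ b - 1) = p ^ Suc b - 1" using p0 by (simp add: p' algebra_simps)
  hence 1: "pdiv p 1 (S (p ^ Suc b - 1) - ((\<Sum>k<p - 1. (cbin k)\<^sup>2) * S (p ^ b - 1) + (cbin (p - 1))\<^sup>2 * S (p ^ b - 1)))"
    using S_blocks_mod_p[of "p ^ b - 1" b "p - 1"] p0 by simp
  have "(\<Sum>k<p - 1. (cbin k)\<^sup>2) + (cbin (p - 1))\<^sup>2 = S (p - 1)"
    using S_less[of "p - 1"] by simp
  hence 2: "(\<Sum>k<p - 1. (cbin k)\<^sup>2) * S (p ^ b - 1) + (cbin (p - 1))\<^sup>2 * S (p ^ b - 1) = S (p - 1) * S (p ^ b - 1)"
    by (simp only: distrib_right [symmetric])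
  have "pdiv p 1 (S (p - 1) - eps)" using pdiv_mono[OF S_mod_p2[OF bounds], of 1] by simp
  from pdiv_diff_mult[OF this Suc pdiv_eps pdiv_S] have "pdiv p 1 (S (p - 1) * S (p ^ b - 1) - eps ^ Suc b)" by simp
  thus ?case using pdiv_trans[OF 1[unfolded 2]] by blast
qed

text \<open>Beyond (p^b - 1)/2 every term vanishes modulo p, so any later cut has the residue of the
  full sum.\<close>

lemma S_partial_power:
  assumes "half_pow b \<le> l" "l < p ^ b"
  shows "pdiv p 1 (S l - eps ^ b)"
proof -
  have "half_pow b \<le> p ^ b - 1" "p ^ b - 1 < p ^ b" using half_pow_eq[of b] by linarith+
  from pdiv_trans[OF pdiv_sym[OF S_above_half_pow[OF this]] S_full_power]
  show ?thesis using pdiv_trans[OF S_above_half_pow[OF assms]] pdiv_sym S_above_half_pow[OF \<open>half_pow b \<le> p ^ b - 1\<close> \<open>p ^ b - 1 < p ^ b\<close>]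
    by blast
qed

section \<open>Comparison of the deformations at p^(b+1) and at p\<close>

lemma pert_factor_p:
  assumes "h \<le> m" shows "pdiv p 2 (pert_factor (of_nat p) h - 1)"
  using assms
proof (induction h)
  case 0
  thus ?case by (simp add: pert_factor_def)
next
  case (Suc h)
  have "pdiv p 0 (1 / of_nat (2 * h + 1))" using Suc.prems p_eq by (intro pdiv_inverse not_p_dvd) linarith+
  hence x: "pdiv p 1 (of_nat p * (1 / of_nat (2 * h + 1)))" by (rule pdiv_p1)
  let ?x = "of_nat p ^ 2 / (2 * of_nat h + 1)\<^sup>2 :: rat"
  have "pdiv p 2 ?x" using pdiv_mult2[OF x x] by (simp add: power2_eq_square add.commute)
  moreover have IH: "pdiv p 2 (pert_factor (of_nat p) h - 1)" using Suc by simp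
  hence "pdiv p 0 (pert_factor (of_nat p) h)" using pdiv_add[OF pdiv_mono[OF IH, of 0] pdiv_1] by simp
  ultimately have "pdiv p 2 ((pert_factor (of_nat p) h - 1) - pert_factor (of_nat p) h * ?x)"
    by (intro pdiv_diff IH pdiv_mult_left)
  thus ?case by (simp add: pert_factor_Suc algebra_simps)
qed

lemma pdiv_pert_factor_p: "h \<le> m \<Longrightarrow> pdiv p 0 (pert_factor (of_nat p) h)"
  using pdiv_add[OF pdiv_mono[OF pert_factor_p, of h 0] pdiv_1] by simp

text \<open>The valuation of n is at most b - 1, two less than that of p^(b+1).\<close>

lemma pdiv_power_div_not_dvd:
  assumes "\<not> p ^ b dvd n"
  shows "pdiv p 2 (of_nat (p ^ Suc b) / of_nat n)"
proof -
  have n: "n \<noteq> 0" using assms by (metis dvd_0_right)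
  have "\<not> is_unit p" using not_prime_unit prime_p by blast
  then obtain u where u: "n = p ^ multiplicity p n * u" "\<not> p dvd u"
    using multiplicity_decompose'[OF n] by metis
  define e where "e = multiplicity p n"
  have "\<not> b \<le> e" using assms u(1) by (metis dvd_mult2 e_def le_imp_power_dvd)
  then obtain d where d: "Suc b = e + 2 + d" by (metis Suc_leI add_2_eq_Suc' le_Suc_ex not_le_imp_less Suc_le_mono)
  have "of_nat (p ^ Suc b) / of_nat n = (of_nat p ^ 2 * (of_nat (p ^ d) * (1 / of_nat u)) :: rat)"
  proof -
    have "of_nat n = of_nat (p ^ e) * (of_nat u :: rat)" using u(1) unfolding e_def by (metis of_nat_mult)
    moreover have "of_nat (p ^ Suc b) = of_nat (p ^ e) * (of_nat p ^ 2 * of_nat (p ^ d) :: rat)"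
      unfolding d by (simp only: power_add of_nat_mult of_nat_power mult.assoc)
    moreover have "of_nat (p ^ e) \<noteq> (0 :: rat)" using prime_gt_0_nat[OF prime_p] by simp
    ultimately show ?thesis by (simp only: mult_divide_mult_cancel_left) simp
  qed
  thus ?thesis using pdiv_p[OF pdiv_mult_left[OF pdiv_inverse[OF u(2)] pdiv_of_nat[of p "p ^ d"]], of 2] by simp
qed

lemma half_pow_div_bound:
  assumes "k \<le> half_pow (Suc b)" shows "(k + half_pow b) div p ^ b \<le> m"
proof -
  have "k + half_pow b < Suc m * p ^ b"
    using assms half_pow_Suc_top[of b] half_pow_eq[of b] by (simp add: mult.commute)
  thus ?thesis using less_mult_imp_div_less less_Suc_eq_le by blast
qed

text \<open>Only factors with p^b dividing 2j + 1 matter, the others being 1 modulo p^4. For 2j + 1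
  = p^b(2h + 1) the factor is the one with index h in the deformation at p, and the quotient in the
  statement counts such j < k.\<close>

lemma pert_factor_power:
  assumes "k \<le> half_pow (Suc b)"
  shows "pdiv p 3 (pert_factor (of_nat (p ^ Suc b)) k - pert_factor (of_nat p) ((k + half_pow b) div p ^ b))"
  using assms
proof (induction k)
  case 0
  show ?case using half_pow_less[of b] by (simp add: pert_factor_def)
next
  case (Suc k)
  define h where "h = (k + half_pow b) div p ^ b"
  define x :: rat where "x = (of_nat (p ^ Suc b) / of_nat (2 * k + 1))\<^sup>2"
  have hm: "h \<le> m" unfolding h_def using Suc.prems by (intro half_pow_div_bound) simp
  have IH: "pdiv p 3 (pert_factor (of_nat (p ^ Suc b)) k - pert_factor (of_nat p) h)" using Suc by (simp add: h_def)
  have g0: "pdiv p 0 (pert_factor (of_nat p) h)" by (rule pdiv_pert_factor_p[OF hm])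
  have gq: "pdiv p 0 (pert_factor (of_nat (p ^ Suc b)) k)" using pdiv_add[OF pdiv_mono[OF IH, of 0] g0] by simp
  have step: "pert_factor (of_nat (p ^ Suc b)) (Suc k) = pert_factor (of_nat (p ^ Suc b)) k * (1 - x)"
    by (simp add: pert_factor_Suc x_def power_divide add.commute)
  \<comment> \<open>The counting quotient increases exactly when a relevant factor is met.\<close>
  have dvd_iff: "p ^ b dvd Suc (k + half_pow b) \<longleftrightarrow> p ^ b dvd 2 * k + 1"
  proof -
    have "2 * Suc (k + half_pow b) = (2 * k + 1) + p ^ b" by (simp add: half_pow_eq [symmetric])
    moreover have "coprime (p ^ b) 2" using odd_p by simp
    ultimately show ?thesis by (metis coprime_dvd_mult_right_iff dvd_add_left_iff dvd_refl)
  qed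
  show ?case
  proof (cases "p ^ b dvd 2 * k + 1")
    case True
    hence dv: "p ^ b dvd Suc (k + half_pow b)" using dvd_iff by simp
    hence h': "(Suc k + half_pow b) div p ^ b = Suc h" by (simp add: h_def div_Suc dvd_eq_mod_eq_0)
    have "Suc (k + half_pow b) = p ^ b * Suc h" using dv h' by (metis add_Suc dvd_mult_div_cancel)
    hence "2 * k + 1 + p ^ b = p ^ b * (2 * h + 1) + p ^ b" using half_pow_eq[of b] by (simp add: algebra_simps)
    hence k: "2 * k + 1 = p ^ b * (2 * h + 1)" by simp
    have "Suc h \<le> m" using half_pow_div_bound[OF Suc.prems] h' by simp
    hence x: "pdiv p 0 x" "x = of_nat p ^ 2 / (2 * of_nat h + 1)\<^sup>2"
    proof -
      have eq: "of_nat (p ^ Suc b) / of_nat (2 * k + 1) = of_nat p * (1 / of_nat (2 * h + 1) :: rat)"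
      proof -
        have "of_nat (p ^ Suc b) = of_nat (p ^ b) * (of_nat p :: rat)" by simp
        moreover have "of_nat (p ^ b) \<noteq> (0 :: rat)" using prime_gt_0_nat[OF prime_p] by simp
        ultimately show ?thesis unfolding k by (simp only: of_nat_mult mult_divide_mult_cancel_left) simp
      qed
      have "pdiv p 0 (1 / of_nat (2 * h + 1))"
        using \<open>Suc h \<le> m\<close> p_eq by (intro pdiv_inverse not_p_dvd) linarith+
      from pdiv_power[OF pdiv_mult_left[OF this pdiv_of_nat[of p p]], of 2] show "pdiv p 0 x"
        unfolding x_def eq .
      show "x = of_nat p ^ 2 / (2 * of_nat h + 1)\<^sup>2"
        unfolding x_def eq by (simp add: power_divide add.commute)
    qed
    have "pert_factor (of_nat p) (Suc h) = pert_factor (of_nat p) h * (1 - x)" by (simp add: pert_factor_Suc x(2))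
    moreover have "pdiv p 3 ((pert_factor (of_nat (p ^ Suc b)) k - pert_factor (of_nat p) h) * (1 - x))"
      by (intro pdiv_mult_right IH pdiv_diff pdiv_1 x(1))
    ultimately show ?thesis unfolding step h' by (simp add: left_diff_distrib)
  next
    case False
    hence "(Suc k + half_pow b) div p ^ b = h" using dvd_iff by (simp add: h_def div_Suc dvd_eq_mod_eq_0)
    moreover have "pdiv p (2 + 2) (of_nat (p ^ Suc b) / of_nat (2 * k + 1) * (of_nat (p ^ Suc b) / of_nat (2 * k + 1)))"
      by (intro pdiv_mult pdiv_power_div_not_dvd False)
    hence "pdiv p 3 x" unfolding x_def power2_eq_square by (rule pdiv_mono) simp
    hence "pdiv p 3 ((pert_factor (of_nat (p ^ Suc b)) k - pert_factor (of_nat p) h) - pert_factor (of_nat (p ^ Suc b)) k * x)"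
      by (intro pdiv_diff IH pdiv_mult_left gq)
    ultimately show ?thesis unfolding step by (simp add: algebra_simps)
  qed
qed

text \<open>In the exact evaluation at p^(b+1) the deformation is replaced by that at p. Since
  \<open>1 - pert_factor\<close> carries p^2, the squares matter only modulo p, where they factor
  over blocks; summing over remainders gives \<open>eps ^ b\<close>, and the exact evaluation at p
  finishes.\<close>

lemma S_half_pow: "pdiv p 3 (S (half_pow (Suc b)) - eps ^ b * S m)"
proof -
  let ?Q = "p ^ b" and ?H = "half_pow b"
  let ?g = "\<lambda>k. 1 - pert_factor (of_nat p) k" and ?h = "\<lambda>k. (k + ?H) div ?Q"
  have exact: "(\<Sum>k\<le>half_pow (Suc b). (cbin k)\<^sup>2 * pert_factor (of_nat (p ^ Suc b)) k) = eps ^ Suc b"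
  proof -
    have "2 * of_nat (half_pow (Suc b)) + 1 = (of_nat (p ^ Suc b) :: rat)"
      unfolding half_pow_eq [symmetric] by simp
    thus ?thesis using sum_cbin_pert_factor[OF order.refl, of "half_pow (Suc b)"] by (simp only: minus_one_power_half_pow)
  qed
  have exact1: "(\<Sum>k\<le>m. (cbin k)\<^sup>2 * pert_factor (of_nat p) k) = eps"
    using sum_cbin_pert_factor[OF order.refl, of m] by (simp add: p_eq add.commute)
  have "pdiv p 3 ((\<Sum>k\<le>half_pow (Suc b). (cbin k)\<^sup>2 * pert_factor (of_nat (p ^ Suc b)) k) - (\<Sum>k\<le>half_pow (Suc b). (cbin k)\<^sup>2 * pert_factor (of_nat p) (?h k)))"
  proof (rule pdiv_diff_sum)
    fix k assume "k \<in> {..half_pow (Suc b)}"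
    hence "pdiv p 3 (pert_factor (of_nat (p ^ Suc b)) k - pert_factor (of_nat p) (?h k))" by (intro pert_factor_power) simp
    from pdiv_mult_left[OF this pdiv_cbin_power2[of k]]
    show "pdiv p 3 ((cbin k)\<^sup>2 * pert_factor (of_nat (p ^ Suc b)) k - (cbin k)\<^sup>2 * pert_factor (of_nat p) (?h k))"
      by (simp only: right_diff_distrib)
  qed
  hence 1: "pdiv p 3 (eps ^ Suc b - (\<Sum>k\<le>half_pow (Suc b). (cbin k)\<^sup>2 * pert_factor (of_nat p) (?h k)))" by (simp only: exact)
  have split: "(\<Sum>k\<le>half_pow (Suc b). (cbin k)\<^sup>2 * ?g (?h k)) =
      (\<Sum>k<m. \<Sum>r<?Q. (cbin (?Q * k + r))\<^sup>2 * ?g (?h (?Q * k + r))) +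
      (\<Sum>r\<le>?H. (cbin (?Q * m + r))\<^sup>2 * ?g (?h (?Q * m + r)))"
    unfolding half_pow_Suc_top by (rule sum_blocks[OF half_pow_less])
  have div_block: "(q * k + s) div q = k" if "s < q" for q k s :: nat
    using that by simp
  have block_term: "pdiv p 3 ((cbin (?Q * k + r))\<^sup>2 * ?g (?h (?Q * k + r)) - (cbin k)\<^sup>2 * ?g k * (cbin r)\<^sup>2)"
    if k: "k \<le> m" "r < ?Q" "k = m \<longrightarrow> r \<le> ?H" for k r
  proof -
    have g: "pdiv p 2 (?g k)" if "k \<le> m" for k using pdiv_sym[OF pert_factor_p[OF that]] .
    show ?thesis
    proof (cases "r \<le> ?H")
      case True
      have "r + ?H < ?Q" using True half_pow_eq[of b] by linarith
      hence "?h (?Q * k + r) = k" unfolding add.assoc by (rule div_block)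
      moreover have "pdiv p 3 (((cbin (?Q * k + r))\<^sup>2 - (cbin k)\<^sup>2 * (cbin r)\<^sup>2) * ?g k)"
        by (rule pdiv_mult3[OF cbin_top_digit_power2(1)[OF k(2)] g[OF k(1)]])
      ultimately show ?thesis by (simp add: algebra_simps)
    next
      \<comment> \<open>The count has moved on to k + 1 here, but \<open>cbin r\<close> is divisible
        by p, so both terms vanish modulo p^3. In the last block k = m this range does not
        occur.\<close>
      case False
      hence km: "Suc k \<le> m" using k by linarith
      have "\<exists>s. r + ?H = ?Q + s \<and> s < ?Q" using False k(2) half_pow_eq[of b] by (intro exI[of _ "r + ?H - ?Q"]) linarith
      then obtain s where "r + ?H = ?Q + s" "s < ?Q" by blast
      hence "?Q * k + r + ?H = ?Q * Suc k + s" "s < ?Q" by simp_all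
      hence h: "?h (?Q * k + r) = Suc k" using div_block[of s ?Q "Suc k"] by (simp only:)
      have "pdiv p 1 (cbin r)" using False k(2) by (intro pdiv_cbin_above_half_pow[of b]) auto
      hence r: "pdiv p 1 ((cbin r)\<^sup>2)" by (simp add: power2_eq_square pdiv_mult_right)
      have "pdiv p 1 ((cbin (?Q * k + r))\<^sup>2)"
        using pdiv_add[OF cbin_top_digit_power2(1)[OF k(2), of k] pdiv_mult_left[OF r pdiv_cbin_power2[of k]]] by simp
      from pdiv_mult3[OF this g[OF km]] have 1: "pdiv p 3 ((cbin (?Q * k + r))\<^sup>2 * ?g (Suc k))" .
      from pdiv_mult_left[OF pdiv_mult3[OF r g[OF k(1)]] pdiv_cbin_power2[of k]]
      have "pdiv p 3 ((cbin k)\<^sup>2 * ?g k * (cbin r)\<^sup>2)" by (simp add: mult_ac)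
      from pdiv_diff[OF 1 this] show ?thesis unfolding h .
    qed
  qed
  have "pdiv p 3 ((\<Sum>k<m. \<Sum>r<?Q. (cbin (?Q * k + r))\<^sup>2 * ?g (?h (?Q * k + r))) - (\<Sum>k<m. \<Sum>r<?Q. (cbin k)\<^sup>2 * ?g k * (cbin r)\<^sup>2))"
    by (intro pdiv_diff_sum block_term) auto
  moreover have "pdiv p 3 ((\<Sum>r\<le>?H. (cbin (?Q * m + r))\<^sup>2 * ?g (?h (?Q * m + r))) - (\<Sum>r\<le>?H. (cbin m)\<^sup>2 * ?g m * (cbin r)\<^sup>2))"
    using half_pow_less[of b] by (intro pdiv_diff_sum block_term) auto
  moreover have "pdiv p 3 ((\<Sum>k<m. \<Sum>r<?Q. (cbin k)\<^sup>2 * ?g k * (cbin r)\<^sup>2) - (\<Sum>k<m. (cbin k)\<^sup>2 * ?g k * eps ^ b))"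
  proof (rule pdiv_diff_sum)
    fix k assume k: "k \<in> {..<m}"
    have pb: "{..<?Q} = {..?Q - 1}" using half_pow_eq[of b] by auto
    from k have "pdiv p 2 (?g k)" using pdiv_sym[OF pert_factor_p[of k]] by simp
    from pdiv_mult_left[OF pdiv_mult3[OF S_full_power[of b] this] pdiv_cbin_power2[of k]]
    show "pdiv p 3 ((\<Sum>r<?Q. (cbin k)\<^sup>2 * ?g k * (cbin r)\<^sup>2) - (cbin k)\<^sup>2 * ?g k * eps ^ b)"
      unfolding pb sum_distrib_left [symmetric] by (simp add: algebra_simps)
  qed
  moreover have "pdiv p 3 ((\<Sum>r\<le>?H. (cbin m)\<^sup>2 * ?g m * (cbin r)\<^sup>2) - (cbin m)\<^sup>2 * ?g m * eps ^ b)"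
  proof -
    have "pdiv p 2 (?g m)" using pdiv_sym[OF pert_factor_p[of m]] by simp
    from pdiv_mult_left[OF pdiv_mult3[OF S_partial_power[OF order.refl half_pow_less[of b]] this] pdiv_cbin_power2[of m]]
    show ?thesis unfolding sum_distrib_left [symmetric] by (simp add: algebra_simps)
  qed
  ultimately have "pdiv p 3 (((\<Sum>k<m. \<Sum>r<?Q. (cbin (?Q * k + r))\<^sup>2 * ?g (?h (?Q * k + r))) - (\<Sum>k<m. (cbin k)\<^sup>2 * ?g k * eps ^ b))
      + ((\<Sum>r\<le>?H. (cbin (?Q * m + r))\<^sup>2 * ?g (?h (?Q * m + r))) - (cbin m)\<^sup>2 * ?g m * eps ^ b))"
    using pdiv_trans pdiv_add by blast
  hence "pdiv p 3 ((\<Sum>k\<le>half_pow (Suc b). (cbin k)\<^sup>2 * ?g (?h k)) - ((\<Sum>k<m. (cbin k)\<^sup>2 * ?g k * eps ^ b) + (cbin m)\<^sup>2 * ?g m * eps ^ b))"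
    unfolding split by (simp only: add_diff_add)
  also have "(\<Sum>k<m. (cbin k)\<^sup>2 * ?g k * eps ^ b) + (cbin m)\<^sup>2 * ?g m * eps ^ b = (\<Sum>k\<le>m. (cbin k)\<^sup>2 * ?g k) * eps ^ b"
    by (simp add: lessThan_Suc_atMost [symmetric] sum_distrib_right distrib_right)
  also have "(\<Sum>k\<le>m. (cbin k)\<^sup>2 * ?g k) = S m - eps"
    unfolding right_diff_distrib sum_subtractf exact1 by simp
  also have "(\<Sum>k\<le>half_pow (Suc b). (cbin k)\<^sup>2 * ?g (?h k)) = S (half_pow (Suc b)) - (\<Sum>k\<le>half_pow (Suc b). (cbin k)\<^sup>2 * pert_factor (of_nat p) (?h k))"
    unfolding right_diff_distrib sum_subtractf by simp
  finally have 2: "pdiv p 3 (S (half_pow (Suc b)) - (\<Sum>k\<le>half_pow (Suc b). (cbin k)\<^sup>2 * pert_factor (of_nat p) (?h k)) - (S m - eps) * eps ^ b)" .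
  have "(s - t - (u - e) * f) - (e * f - t) = s - f * u" for s t u e f :: rat by (simp add: algebra_simps)
  with pdiv_diff[OF 2 1] show ?thesis by (simp only: power_Suc)
qed

text \<open>\<open>S_half_pow\<close> covers everything up to the middle of block m. The rest of
  that block vanishes because its \<open>cbin\<close> values carry p^2, and above it p divides the
  leading \<open>cbin\<close>, so block factorisation holds modulo p^3.\<close>

lemma S_blocks_upper:
  assumes "l < p ^ b" "m < t" "t < p"
  shows "pdiv p 3 (S (p ^ b * t + l) - (eps ^ b * (\<Sum>k<t. (cbin k)\<^sup>2) + (cbin t)\<^sup>2 * S l))"
proof -
  let ?Q = "p ^ b" and ?H = "half_pow b" and ?f = "\<lambda>k. \<Sum>r<p ^ b. (cbin (p ^ b * k + r))\<^sup>2"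
  have pb: "{..<?Q} = {..?Q - 1}" using half_pow_eq[of b] by auto
  obtain d where d: "t = Suc m + d" using assms(2) less_iff_Suc_add by auto
  have shift: "(\<Sum>k<Suc m + n. f k) = (\<Sum>k<m. f k) + f m + (\<Sum>k<n. f (Suc m + k))" for n and f :: "nat \<Rightarrow> rat"
    by (induction n) simp_all
  have A: "S (half_pow (Suc b)) = (\<Sum>k<m. ?f k) + (\<Sum>r\<le>?H. (cbin (?Q * m + r))\<^sup>2)"
    unfolding half_pow_Suc_top by (rule sum_blocks[OF half_pow_less])
  have "?f m - (\<Sum>r\<le>?H. (cbin (?Q * m + r))\<^sup>2) = (\<Sum>r\<in>{..<?Q} - {..?H}. (cbin (?Q * m + r))\<^sup>2)"
    using half_pow_less[of b] by (subst sum_diff) auto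
  also have "pdiv p 3 \<dots>"
  proof (rule pdiv_sum)
    fix r assume "r \<in> {..<?Q} - {..?H}"
    hence "pdiv p 2 (cbin (?Q * m + r))" by (intro pdiv_cbin_middle) auto
    from pdiv_mult[OF this this] show "pdiv p 3 ((cbin (?Q * m + r))\<^sup>2)"
      unfolding power2_eq_square by (rule pdiv_mono) simp
  qed
  finally have B: "pdiv p 3 (?f m - (\<Sum>r\<le>?H. (cbin (?Q * m + r))\<^sup>2))" .
  have C: "pdiv p 3 ((\<Sum>k<d. ?f (Suc m + k)) - (\<Sum>k<d. eps ^ b * (cbin (Suc m + k))\<^sup>2))"
  proof (rule pdiv_diff_sum)
    fix k assume "k \<in> {..<d}"
    hence u: "pdiv p 1 (cbin (Suc m + k))" using assms(3) d by (intro pdiv_cbin_upper) auto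
    have "pdiv p 3 (?f (Suc m + k) - (\<Sum>r<?Q. (cbin (Suc m + k))\<^sup>2 * (cbin r)\<^sup>2))"
      by (intro pdiv_diff_sum cbin_top_digit_power2(2) u) simp
    moreover have "pdiv p 3 ((S (?Q - 1) - eps ^ b) * (cbin (Suc m + k) * cbin (Suc m + k)))"
      by (rule pdiv_mult3[OF S_full_power pdiv_mult2[OF u u]])
    hence "pdiv p 3 ((\<Sum>r<?Q. (cbin (Suc m + k))\<^sup>2 * (cbin r)\<^sup>2) - eps ^ b * (cbin (Suc m + k))\<^sup>2)"
      unfolding pb sum_distrib_left [symmetric] by (simp add: algebra_simps power2_eq_square)
    ultimately show "pdiv p 3 (?f (Suc m + k) - eps ^ b * (cbin (Suc m + k))\<^sup>2)" by (rule pdiv_trans)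
  qed
  have u: "pdiv p 1 (cbin t)" by (rule pdiv_cbin_upper[OF assms(2,3)])
  have D: "pdiv p 3 ((\<Sum>r\<le>l. (cbin (?Q * t + r))\<^sup>2) - (\<Sum>r\<le>l. (cbin t)\<^sup>2 * (cbin r)\<^sup>2))"
    using assms(1) by (intro pdiv_diff_sum cbin_top_digit_power2(2) u) simp
  have "S (?Q * t + l) - (eps ^ b * (\<Sum>k<t. (cbin k)\<^sup>2) + (cbin t)\<^sup>2 * S l) =
     (S (half_pow (Suc b)) - eps ^ b * S m) + (?f m - (\<Sum>r\<le>?H. (cbin (?Q * m + r))\<^sup>2))
     + ((\<Sum>k<d. ?f (Suc m + k)) - (\<Sum>k<d. eps ^ b * (cbin (Suc m + k))\<^sup>2))
     + ((\<Sum>r\<le>l. (cbin (?Q * t + r))\<^sup>2) - (\<Sum>r\<le>l. (cbin t)\<^sup>2 * (cbin r)\<^sup>2))"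
  proof -
    have 1: "S (?Q * t + l) = (\<Sum>k<m. ?f k) + ?f m + (\<Sum>k<d. ?f (Suc m + k)) + (\<Sum>r\<le>l. (cbin (?Q * t + r))\<^sup>2)"
      unfolding sum_blocks[OF assms(1)] by (simp only: d shift)
    have 2: "(\<Sum>k<t. (cbin k)\<^sup>2) = S m + (\<Sum>k<d. (cbin (Suc m + k))\<^sup>2)"
      unfolding d shift by (simp add: lessThan_Suc_atMost [symmetric])
    show ?thesis unfolding 1 2 A sum_distrib_left [symmetric] by (simp only: distrib_left)
  qed
  thus ?thesis using pdiv_add[OF pdiv_add[OF pdiv_add[OF S_half_pow B] C] D] by (simp only:)
qed

text \<open>\<open>cbin i\<close> is (-1)^i times the generalised binomial of -1/2 over i, and -1/2
  is m modulo p.\<close>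

lemma cbin_binomial:
  assumes "i \<le> m"
  shows "pdiv p 1 (cbin i - (-1) ^ i * of_nat (m choose i))"
  using assms
proof (induction i)
  case 0
  thus ?case by simp
next
  case (Suc i)
  let ?C = "of_nat (m choose i) :: rat" and ?v = "1 / of_nat (2 * Suc i) :: rat"
  have "Suc i * (m choose Suc i) = (m - i) * (m choose i)"
    using binomial_absorption[of i m] binomial_absorb_comp[of m i] by simp
  hence "of_nat (Suc i) * (of_nat (m choose Suc i) :: rat) = (of_nat m - of_nat i) * ?C"
    using Suc.prems by (metis Suc_leD of_nat_diff of_nat_mult)
  hence C: "(of_nat (m choose Suc i) :: rat) = (2 * of_nat m - 2 * of_nat i) * ?v * ?C"
    using of_nat_neq_0[of i, where ?'a = rat] by (simp add: field_simps)
  have cbin: "cbin (Suc i) = cbin i * ((2 * of_nat i + 1) * ?v)" unfolding cbin_Suc by simp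
  have v: "pdiv p 0 ?v" using Suc.prems p_eq by (intro pdiv_inverse not_p_dvd_double not_p_dvd) linarith+
  have IH: "pdiv p 1 (cbin i - (-1) ^ i * ?C)" using Suc by simp
  have "pdiv p 1 ((cbin i - (-1) ^ i * ?C) * (of_nat (2 * i + 1) * ?v) + of_nat p * ((-1) ^ i * (?C * ?v)))"
    by (intro pdiv_add pdiv_mult_right[OF IH] pdiv_p1 pdiv_mult_left v pdiv_of_nat pdiv_power pdiv_uminus pdiv_1)
  moreover have "of_nat p = (2 * of_nat m + 1 :: rat)" "of_nat (2 * i + 1) = (2 * of_nat i + 1 :: rat)" by (simp_all add: p_eq)
  moreover have "(x - s * c) * ((2 * j + 1) * v) + (2 * n + 1) * (s * (c * v))
      = x * ((2 * j + 1) * v) - (- 1 * s) * ((2 * n - 2 * j) * v * c)" for x s c j v n :: rat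
    by (simp add: algebra_simps)
  ultimately show ?case unfolding C cbin power_Suc by (simp only:)
qed

text \<open>For m = 2M + 1 the squares of the binomials m over i split evenly about m/2, so S(M) is
  half of S(m) modulo p.\<close>

lemma S_quarter:
  assumes "m = M + Suc M"
  shows "pdiv p 1 (2 * S M - eps)"
proof -
  let ?q = "\<lambda>i. (of_nat (m choose i))\<^sup>2 :: rat"
  have sq: "pdiv p 1 ((cbin i)\<^sup>2 - ?q i)" if "i \<le> m" for i
  proof -
    have "((-1) ^ i * of_nat (m choose i) :: rat)\<^sup>2 = ?q i" by (simp add: power_mult_distrib flip: power_mult)
    moreover have "pdiv p 1 ((cbin i)\<^sup>2 - ((-1) ^ i * of_nat (m choose i))\<^sup>2)"
      by (intro pdiv_diff_power2 cbin_binomial that pdiv_cbin pdiv_mult_left pdiv_of_nat pdiv_power pdiv_uminus pdiv_1)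
    ultimately show ?thesis by (simp only:)
  qed
  have "sum ?q {..<Suc M + Suc M} = sum ?q {..<Suc M} + sum ?q {..<Suc M}"
  proof (rule sum_symmetric_split)
    fix i assume "i < Suc M + Suc M"
    hence i: "i \<le> m" and eq: "Suc M + Suc M - 1 - i = m - i" using assms by linarith+
    show "?q (Suc M + Suc M - 1 - i) = ?q i" unfolding eq by (simp only: binomial_symmetric[OF i, symmetric])
  qed
  moreover have "{..<Suc M + Suc M} = {..m}" "{..<Suc M} = {..M}" using assms by auto
  ultimately have sym: "sum ?q {..m} = sum ?q {..M} + sum ?q {..M}" by (simp only:)
  have 1: "pdiv p 1 (S M - sum ?q {..M})" "pdiv p 1 (S m - sum ?q {..m})"
    using assms by (intro pdiv_diff_sum sq; simp)+
  have "m < p" using p_eq by linarith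
  from pdiv_mono[OF S_mod_p2[OF order.refl this], of 1] have 2: "pdiv p 1 (S m - eps)" by simp
  have "pdiv p 1 (2 * (S M - sum ?q {..M}) - (S m - sum ?q {..m}) + (S m - eps))"
    by (intro pdiv_add pdiv_diff pdiv_mult_left 1 2) simp
  thus ?thesis unfolding sym by (simp add: algebra_simps)
qed

section \<open>The cut at 3/4 of a prime power\<close>

lemma sum_three_quarters_power_1:
  assumes "m = L + L"
  shows "pdiv p 3 (S (3 * p ^ Suc b div 4) - eps ^ Suc b)"
proof -
  let ?t = "m + L"
  define l where "l = 3 * p ^ b div 4"
  have p4: "p = 4 * L + 1" using p_eq assms by simp
  have L: "L > 0" using m_pos assms by simp
  \<comment> \<open>From 3p = 4(m + L) + 3 the top digit of the cut is m + L, and the remainder is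
    again a three-quarter cut, beyond half of p^b.\<close>
  have "3 * p ^ Suc b = 4 * (p ^ b * ?t) + 3 * p ^ b" unfolding power_Suc assms by (subst p4) (simp add: algebra_simps)
  hence N: "3 * p ^ Suc b div 4 = p ^ b * ?t + l" by (simp add: l_def)
  have l: "half_pow b \<le> l" "l < p ^ b" using half_pow_eq[of b] unfolding l_def by linarith+
  have t: "m < ?t" "?t < p" using L assms p4 by simp_all
  have u: "pdiv p 1 (cbin ?t)" by (rule pdiv_cbin_upper[OF t])
  have 1: "pdiv p 3 (S (p ^ b * ?t + l) - (eps ^ b * (\<Sum>k<?t. (cbin k)\<^sup>2) + (cbin ?t)\<^sup>2 * S l))"
    by (rule S_blocks_upper[OF l(2) t])
  \<comment> \<open>The square of \<open>cbin\<close> at the top digit carries p^2, so the remainder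
    sum is needed only modulo p.\<close>
  have 2: "pdiv p 3 ((S l - eps ^ b) * (cbin ?t * cbin ?t))"
    by (rule pdiv_mult3[OF S_partial_power[OF l] pdiv_mult2[OF u u]])
  have 3: "pdiv p 3 (eps ^ b * (S ?t - eps))" by (rule pdiv_mult_left[OF sum_three_quarters_1[OF assms] pdiv_eps_power])
  have 4: "S ?t = (\<Sum>k<?t. (cbin k)\<^sup>2) + (cbin ?t)\<^sup>2" by (simp add: lessThan_Suc_atMost [symmetric])
  have "(x - (e * y + z\<^sup>2 * w)) + (w - e) * (z * z) + e * ((y + z\<^sup>2) - f) = x - f * e" for x e y z w f :: rat
    by (simp add: algebra_simps power2_eq_square)
  with pdiv_add[OF pdiv_add[OF 1 2] 3] show ?thesis unfolding N 4 power_Suc[of eps b] by (simp only:)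
qed

text \<open>Here 3p = 4(m + M + 1) + 1, so the last block is cut at a quarter. Its sum is half of a
  full block modulo p, so only half of the middle term is counted, which removes the correction
  present for p itself.\<close>

lemma sum_three_quarters_power_3:
  assumes "m = M + Suc M"
  shows "pdiv p 3 (S (3 * p ^ Suc (Suc c) div 4) - eps ^ Suc (Suc c))"
proof -
  let ?t = "m + M + 1" and ?b = "Suc c"
  have two: "pdiv p 0 2" by simp
  define l l' where "l = p ^ ?b div 4" and "l' = 3 * p ^ c div 4"
  have p4: "p = 4 * M + 3" using p_eq assms by simp
  have "3 * p ^ Suc ?b = 4 * (p ^ ?b * ?t) + p ^ ?b" unfolding power_Suc[of p ?b] assms by (subst p4) (simp add: algebra_simps)
  hence N: "3 * p ^ Suc ?b div 4 = p ^ ?b * ?t + l" by (simp add: l_def)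
  \<comment> \<open>A quarter cut has leading digit M and a three-quarter cut below it. This needs
    at least one digit in the remainder, hence an exponent of at least 2.\<close>
  have "p ^ ?b = 4 * (p ^ c * M) + 3 * p ^ c" unfolding power_Suc by (subst p4) (simp add: algebra_simps)
  hence l: "l = p ^ c * M + l'" by (simp add: l_def l'_def)
  have l': "half_pow c \<le> l'" "l' < p ^ c" using half_pow_eq[of c] unfolding l'_def by linarith+
  have lb: "l < p ^ ?b" using half_pow_eq[of ?b] unfolding l_def by linarith
  have t: "m < ?t" "?t < p" using assms p4 by simp_all
  have u: "pdiv p 1 (cbin ?t)" by (rule pdiv_cbin_upper[OF t])
  have Sl: "pdiv p 1 (2 * S l - eps ^ ?b)"
  proof -
    have 1: "pdiv p 1 (S l - ((\<Sum>k<M. (cbin k)\<^sup>2) * S (p ^ c - 1) + (cbin M)\<^sup>2 * S l'))"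
      unfolding l by (rule S_blocks_mod_p[OF l'(2)])
    have 2: "pdiv p 1 ((\<Sum>k<M. (cbin k)\<^sup>2) * (S (p ^ c - 1) - eps ^ c))"
      by (intro pdiv_mult_left S_full_power pdiv_sum pdiv_cbin_power2)
    have 3: "pdiv p 1 ((cbin M)\<^sup>2 * (S l' - eps ^ c))"
      by (intro pdiv_mult_left S_partial_power l' pdiv_cbin_power2)
    have 4: "pdiv p 1 (eps ^ c * (2 * S M - eps))" by (rule pdiv_mult_left[OF S_quarter[OF assms] pdiv_eps_power])
    have 5: "S M = (\<Sum>k<M. (cbin k)\<^sup>2) + (cbin M)\<^sup>2" by (simp add: lessThan_Suc_atMost [symmetric])
    have "2 * ((x - (y * z + w * v)) + y * (z - e) + w * (v - e)) + e * (2 * (y + w) - f) = 2 * x - f * e" for x y z w v e f :: rat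
      by (simp add: algebra_simps)
    with pdiv_add[OF pdiv_mult_left[OF pdiv_add[OF pdiv_add[OF 1 2] 3] two] 4]
    show ?thesis unfolding 5 power_Suc by (simp only:)
  qed
  have 1: "pdiv p 3 (S (p ^ ?b * ?t + l) - (eps ^ ?b * (\<Sum>k<?t. (cbin k)\<^sup>2) + (cbin ?t)\<^sup>2 * S l))"
    by (rule S_blocks_upper[OF lb t])
  have 2: "pdiv p 3 ((2 * S l - eps ^ ?b) * (cbin ?t * cbin ?t))"
    by (rule pdiv_mult3[OF Sl pdiv_mult2[OF u u]])
  have m1: "m - 1 = 2 * M" "m + 1 + M = ?t" "M < m" using assms by linarith+
  have "pdiv p 3 (2 * (S ?t - eps) - of_nat p ^ 2 / (of_nat ((2 * M) choose M))\<^sup>2)"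
    using sum_three_quarters_3[OF assms] .
  moreover have "pdiv p 3 ((cbin ?t)\<^sup>2 - of_nat p ^ 2 / (of_nat ((2 * M) choose M))\<^sup>2)"
    using cbin_upper_power2(1)[OF m1(3)] unfolding m1 .
  ultimately have "pdiv p 3 (2 * (S ?t - eps) - (cbin ?t)\<^sup>2)" by (metis pdiv_trans pdiv_sym)
  hence 3: "pdiv p 3 (eps ^ ?b * (2 * (S ?t - eps) - (cbin ?t)\<^sup>2))" by (rule pdiv_mult_left[OF _ pdiv_eps_power])
  have 4: "S ?t = (\<Sum>k<?t. (cbin k)\<^sup>2) + (cbin ?t)\<^sup>2" by (simp add: lessThan_Suc_atMost [symmetric])
  have "2 * (x - (e * y + z\<^sup>2 * w)) + (2 * w - e) * (z * z) + e * (2 * ((y + z\<^sup>2) - f) - z\<^sup>2) = 2 * (x - f * e)" for x e y z w f :: rat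
    by (simp add: algebra_simps power2_eq_square)
  with pdiv_add[OF pdiv_add[OF pdiv_mult_left[OF 1 two] 2] 3]
  have "pdiv p 3 (2 * (S (p ^ ?b * ?t + l) - eps * eps ^ ?b))" unfolding 4 by (simp only:)
  thus ?thesis unfolding N power_Suc[of eps ?b] by (rule pdiv_half)
qed

text \<open>Euler's criterion gives a congruence modulo p between integers of absolute value at most
  1; as p > 2, they are equal.\<close>

lemma Jacobi_minus_one: "(of_int (Jacobi (- 1) (p ^ a)) :: rat) = eps ^ a"
proof -
  have p2: "2 < p" using m_pos p_eq by simp
  have "[Legendre (-1) (int p) = (-1) ^ m] (mod int p)"
    using euler_criterion[OF prime_p p2, of "-1"] by (simp add: p_eq)
  hence d: "int p dvd Legendre (-1) (int p) - (-1) ^ m" by (simp add: cong_iff_dvd_diff)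
  have "\<bar>Legendre (-1) (int p)\<bar> \<le> 1" by (simp add: Legendre_def)
  moreover have "\<bar>(-1) ^ m :: int\<bar> = 1" by (simp add: power_abs)
  ultimately have "\<bar>Legendre (-1) (int p) - (-1) ^ m\<bar> < int p" using p2 by linarith
  hence "Legendre (-1) (int p) = (-1) ^ m" using d not_dvd_of_small[of "Legendre (-1) (int p) - (-1) ^ m" p] by fastforce
  thus ?thesis by (simp add: Jacobi_prime_power[OF prime_p])
qed

end

theorem theorem1p1:
  fixes p :: nat
  assumes "prime p" and "odd p"
  shows
    "([p = 1] (mod 4) \<longrightarrow>
        rat_cong (\<Sum>k = 0..(3 * p) div 4. (of_nat ((2 * k) choose k))\<^sup>2 / 16 ^ k) 1 p 3) \<and>
     ([p = 3] (mod 4) \<longrightarrow>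
        rat_cong (\<Sum>k = 0..(3 * p) div 4. (of_nat ((2 * k) choose k))\<^sup>2 / 16 ^ k)
          (- 1 + (of_nat p)\<^sup>2 / (2 * (of_nat (((p - 3) div 2) choose ((p - 3) div 4)))\<^sup>2)) p 3) \<and>
     (\<forall>a\<ge>2. rat_cong (\<Sum>k = 0..(3 * p ^ a) div 4. (of_nat ((2 * k) choose k))\<^sup>2 / 16 ^ k)
        (of_int (Jacobi (- 1) (p ^ a))) p 3)"
proof -
  obtain m where pm: "p = 2 * m + 1" using assms(2) by (elim oddE)
  interpret odd_prime p m by unfold_locales (use assms pm in auto)
  have S: "(\<Sum>k = 0..N. (of_nat ((2 * k) choose k))\<^sup>2 / 16 ^ k) = S N" for N
    by (simp only: cbin_power2 atMost_atLeast0)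
  have cases: "(\<exists>L. m = L + L) \<or> (\<exists>M. m = M + Suc M)"
  proof (cases "even m")
    case True
    then obtain L where "m = 2 * L" by (elim evenE)
    thus ?thesis by (intro disjI1 exI[of _ L]) simp
  next
    case False
    then obtain M where "m = 2 * M + 1" by (elim oddE)
    thus ?thesis by (intro disjI2 exI[of _ M]) simp
  qed
  show ?thesis unfolding S
  proof (intro conjI impI allI)
    assume "[p = 1] (mod 4)"
    hence "p mod 4 = 1" by (simp add: cong_def)
    hence ev: "m mod 2 = 0" using pm by presburger
    then obtain L where L: "m = L + L" using cases by auto
    have "3 * p div 4 = m + L" using pm L by simp
    moreover have "eps = 1" using ev by (simp add: even_iff_mod_2_eq_zero)
    ultimately show "rat_cong (S (3 * p div 4)) 1 p 3"
      using sum_three_quarters_1[OF L] by (intro rat_congI) simp_all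
  next
    assume "[p = 3] (mod 4)"
    hence "p mod 4 = 3" by (simp add: cong_def)
    hence od: "m mod 2 = 1" using pm by presburger
    then obtain M where M: "m = M + Suc M" using cases by auto
    have N: "3 * p div 4 = m + M + 1" "(p - 3) div 2 = 2 * M" "(p - 3) div 4 = M" "m - 1 = 2 * M" "M < m" using pm M by simp_all
    have e: "eps = - 1" using od by (simp add: odd_iff_mod_2_eq_one)
    let ?C = "of_nat ((2 * M) choose M) :: rat"
    have C: "pdiv p 0 (1 / ?C\<^sup>2)" using cbin_upper_power2(2)[OF N(5)] unfolding N(4) .
    have "2 * (s - (- 1 + q / (2 * c))) = 2 * (s - - 1) - q / c" for s q c :: rat by simp
    hence "pdiv p 3 (2 * (S (m + M + 1) - (- 1 + of_nat p ^ 2 / (2 * ?C\<^sup>2))))"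
      using sum_three_quarters_3[OF M] unfolding e by (simp only:)
    hence 1: "pdiv p 3 (S (m + M + 1) - (- 1 + of_nat p ^ 2 / (2 * ?C\<^sup>2)))" by (rule pdiv_half)
    \<comment> \<open>Integrality of the right-hand side is recovered from the integral sum and the
      divisible difference.\<close>
    have "pdiv p 0 (S (m + M + 1) - (S (m + M + 1) - (- 1 + of_nat p ^ 2 / (2 * ?C\<^sup>2))))"
      by (rule pdiv_diff[OF pdiv_S pdiv_mono[OF 1]]) simp
    hence "pdiv p 0 (- 1 + of_nat p ^ 2 / (2 * ?C\<^sup>2))" by simp
    thus "rat_cong (S (3 * p div 4)) (- 1 + (of_nat p)\<^sup>2 / (2 * (of_nat (((p - 3) div 2) choose ((p - 3) div 4)))\<^sup>2)) p 3"
      unfolding N by (intro rat_congI 1)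
  next
    fix a :: nat assume "2 \<le> a"
    then obtain c where a: "a = Suc (Suc c)" by (metis Suc_le_D numeral_2_eq_2 Suc_le_mono)
    have "pdiv p 3 (S (3 * p ^ a div 4) - eps ^ a)"
      unfolding a using cases sum_three_quarters_power_1 sum_three_quarters_power_3 by blast
    thus "rat_cong (S (3 * p ^ a div 4)) (of_int (Jacobi (- 1) (p ^ a))) p 3"
      unfolding Jacobi_minus_one by (intro rat_congI pdiv_eps_power)
  qed
qed

end
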